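(* Let $H_o$ be the multivariate normal distribution $N(\mathbf{0},\mathbf{I}_{p+1})$. Let $\mathbf{T}_{MM}$ be an MM-estimate of the regression slopes with loss functions $\rho_1,\rho_2$ both satisfying A3, with $\rho_1\ge\rho_2$, $\rho_1\ne\rho_2$, and let $B_{MM}(\varepsilon)$ be its maximum bias function. Assume that the maximum bias function $B_S(\varepsilon)$ of the S-estimate of the regression slopes with score function $\rho_1$ (and constant $b$) satisfies $B_S(\varepsilon)<h_1^{-1}[\varepsilon/(1-\varepsilon)]$, and that $g_2$ satisfies A4. Then $$\ell(\varepsilon)\le B_{MM}(\varepsilon)\le\max\{\ell(\varepsilon),u(\varepsilon)\},$$ where $$\ell(\varepsilon)=\left[\left(\frac{\sigma_{b,\varepsilon}}{g_2^{-1}[g_2(\sigma_{b,\varepsilon})+\varepsilon/(1-\varepsilon)]}\right)^2-1\right]^{1/2},\qquad u(\varepsilon)=\left[\left(\frac{\gamma_{b,\varepsilon}}{g_2^{-1}[g_2(\gamma_{b,\varepsilon})+\varepsilon/(1-\varepsilon)]}\right)^2-1\right]^{1/2}.$$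
   Context: Model. $(y,\mathbf{x})\in\mathbb{R}\times\mathbb{R}^p$ has joint distribution $H_o=N(\mathbf{0},\mathbf{I}_{p+1})$; $F_o=N(0,1)$ is the distribution of $y$. Condition A3 (for a function $\rho:\mathbb{R}\to[0,\infty)$): (i) $\rho$ is symmetric, nondecreasing on $[0,\infty)$, $\rho(0)=0$; (ii) $\rho$ is bounded with $\lim_{u\to\infty}\rho(u)=1$; (iii) $\rho$ has only finitely many discontinuities. Condition A4 (for a function $g$ on $(0,\infty)$): (i) $g$ is continuously differentiable; (ii) $\phi(s)=-s\,g'(s)$ is unimodal, with its maximum attained at a point $\sigma_M$. Maximum bias. For $0<\varepsilon<1$, $V_\varepsilon=\{(1-\varepsilon)H_o+\varepsilon H^*: H^* \text{ any probability distribution on }\mathbb{R}^{p+1}\}$. For an $\mathbb{R}^p$-valued functional $\mathbf{T}$ (with $\mathbf{T}(H_o)=\mathbf{0}$, weakly continuous at $H_o$), the asymptotic bias at $H$ is $b(\mathbf{T},H)=\|\mathbf{T}(H)\|$ (Euclidean norm) if $\mathbf{T}(H)$ is defined and finite, and $b(\mathbf{T},H)=\infty$ otherwise; the maximum bias function is $B_{\mathbf{T}}(\varepsilon)=\sup\{b(\mathbf{T},H):H\in V_\varepsilon\}$. S-estimates. Given $\rho$ and $b\in(0,1)$, the S-estimates of intercept, slopes and scale $\{t_S(H),\mathbf{T}_S(H),\sigma_S(H)\}$ are the solution $(\alpha,\boldsymbol{\theta},\sigma)$ of the problem of minimizing $\sigma>0$ subject to $E_H[\rho((y-\alpha-\mathbf{x}'\boldsymbol{\theta})/\sigma)]\le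 b$. MM-estimates. Set $b=E_{F_o}\rho_1(Y)$, and let $s(H)=\sigma_S(H)$ be the S-scale based on $\rho=\rho_1$ and this $b$. The MM-estimates $\{t_{MM}(H),\mathbf{T}_{MM}(H)\}$ are the solution $(\alpha,\boldsymbol{\theta})$ minimizing $E_H[\rho_2((y-\alpha-\mathbf{x}'\boldsymbol{\theta})/s(H))]$ over $\alpha\in\mathbb{R}$, $\boldsymbol{\theta}\in\mathbb{R}^p$. Notation. $\overline{s}=\sup_{H\in V_\varepsilon}s(H)$ and, for $t\ge0$, $$h_1(t)=\inf_{\|\boldsymbol{\theta}\|=t}\ \inf_{\alpha\in\mathbb{R}}E_{H_o}\rho_2\left(\frac{y-\alpha-\mathbf{x}'\boldsymbol{\theta}}{\overline{s}}\right)-E_{H_o}\rho_2\left(\frac{y}{\overline{s}}\right);$$ $h_1^{-1}(v)$ is the $t\ge0$ with $h_1(t)=v$. With $Z$ standard normal, $g_i(s)=E\rho_i(Z/s)$ for $s>0$, $i=1,2$; $\sigma_{b,\varepsilon}=g_1^{-1}[(b-\varepsilon)/(1-\varepsilon)]$ and $\gamma_{b,\varepsilon}=g_1^{-1}[b/(1-\varepsilon)]$. The amount of contamination satisfies $0<\varepsilon<\min\{b,1-b\}$ and is such that the inverse values appearing in $\ell(\varepsilon)$ and $u(\varepsilon)$ exist (i.e. the arguments of $g_2^{-1}$ are less than $1$).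
   Formalization: It is additionally assumed that the MM minimization problem has a solution at every H in V_ε; otherwise the bias is infinite and the upper bound fails, e.g. for ρ_1=1{|u|>k}, ρ_2=1{|u|≥c} with c large. *)

theory Defs
  imports "HOL-Probability.Probability"
begin

text \<open>
  A regression observation is a pair \<open>(y, x)\<close> of type \<open>real \<times> (real ^ 'p)\<close>.
\<close>

definition std_gaussian :: "('a::euclidean_space) measure" where
  "std_gaussian = density lborel (\<lambda>z. ennreal (\<Prod>b\<in>Basis. std_normal_density (z \<bullet> b)))"

abbreviation Ho :: "(real \<times> (real ^ 'p)) measure" where
  "Ho \<equiv> std_gaussian"

definition cond_A3 :: "(real \<Rightarrow> real) \<Rightarrow> bool" where
  "cond_A3 \<rho> \<longleftrightarrow>
     (\<forall>u. 0 \<le> \<rho> u) \<and>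
     (\<forall>u. \<rho> (- u) = \<rho> u) \<and> mono_on {0..} \<rho> \<and> \<rho> 0 = 0 \<and>
     bounded (range \<rho>) \<and> (\<rho> \<longlongrightarrow> 1) at_top \<and>
     finite {u. \<not> isCont \<rho> u}"

text \<open>Unimodality is understood in the weak sense: nondecreasing up to \<open>\<sigma>\<^sub>M\<close>, nonincreasing from there on.\<close>

definition cond_A4 :: "(real \<Rightarrow> real) \<Rightarrow> bool" where
  "cond_A4 g \<longleftrightarrow>
     g C1_differentiable_on {0<..} \<and>
     (\<exists>\<sigma>\<^sub>M>0. mono_on {0<..\<sigma>\<^sub>M} (\<lambda>s. - s * deriv g s) \<and>
              antimono_on {\<sigma>\<^sub>M..} (\<lambda>s. - s * deriv g s))"


subsection \<open>Contamination neighbourhood and maximum bias\<close>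

definition prob_measures :: "('a::topological_space) measure set" where
  "prob_measures = {H. prob_space H \<and> sets H = sets borel}"

text \<open>\<open>contam \<epsilon>\<close> is the neighbourhood \<open>V\<^sub>\<epsilon>\<close> of all mixtures \<open>(1-\<epsilon>) H\<^sub>o + \<epsilon> H\<^sup>*\<close>.\<close>

definition contam :: "real \<Rightarrow> (real \<times> (real ^ 'p)) measure set" where
  "contam \<epsilon> = {H \<in> prob_measures. \<exists>H' \<in> prob_measures.
      \<forall>A \<in> sets borel. measure H A = (1 - \<epsilon>) * measure Ho A + \<epsilon> * measure H' A}"

text \<open>A functional may be undefined (\<open>None\<close>) at some distributions; its bias there is infinite.\<close>

definition bias :: "((real \<times> (real ^ 'p)) measure \<Rightarrow> (real ^ 'p) option)
    \<Rightarrow> (real \<times> (real ^ 'p)) measure \<Rightarrow> ereal" where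
  "bias T H = (case T H of None \<Rightarrow> \<infinity> | Some \<theta> \<Rightarrow> ereal (norm \<theta>))"

definition max_bias :: "((real \<times> (real ^ 'p)) measure \<Rightarrow> (real ^ 'p) option) \<Rightarrow> real \<Rightarrow> ereal" where
  "max_bias T \<epsilon> = (SUP H \<in> contam \<epsilon>. bias T H)"


subsection \<open>S-estimates and MM-estimates\<close>

definition risk :: "(real \<Rightarrow> real) \<Rightarrow> (real \<times> (real ^ 'p)) measure
    \<Rightarrow> real \<Rightarrow> real ^ 'p \<Rightarrow> real \<Rightarrow> real" where
  "risk \<rho> H \<alpha> \<theta> \<sigma> = (\<integral>(y, x). \<rho> ((y - \<alpha> - x \<bullet> \<theta>) / \<sigma>) \<partial>H)"

definition S_solution :: "(real \<Rightarrow> real) \<Rightarrow> real \<Rightarrow> (real \<times> (real ^ 'p)) measure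
    \<Rightarrow> real \<Rightarrow> real ^ 'p \<Rightarrow> real \<Rightarrow> bool" where
  "S_solution \<rho> b H \<alpha> \<theta> \<sigma> \<longleftrightarrow>
     \<sigma> > 0 \<and> risk \<rho> H \<alpha> \<theta> \<sigma> \<le> b \<and>
     (\<forall>\<alpha>' \<theta>' \<sigma>'. \<sigma>' > 0 \<and> risk \<rho> H \<alpha>' \<theta>' \<sigma>' \<le> b \<longrightarrow> \<sigma> \<le> \<sigma>')"

text \<open>
  \<open>is_S_scale \<rho> b H s\<close> says that \<open>s = \<sigma>\<^sub>S(H)\<close>.  The scale component of a solution is unique
  whenever a solution exists, the regression parameters need not be.
\<close>

definition is_S_scale :: "(real \<Rightarrow> real) \<Rightarrow> real \<Rightarrow> (real \<times> (real ^ 'p)) measure \<Rightarrow> real \<Rightarrow> bool" where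
  "is_S_scale \<rho> b H s \<longleftrightarrow> (\<exists>\<alpha> \<theta>. S_solution \<rho> b H \<alpha> \<theta> s)"

definition MM_solution :: "(real \<Rightarrow> real) \<Rightarrow> (real \<Rightarrow> real) \<Rightarrow> real \<Rightarrow> (real \<times> (real ^ 'p)) measure
    \<Rightarrow> real \<Rightarrow> real ^ 'p \<Rightarrow> bool" where
  "MM_solution \<rho>1 \<rho>2 b H \<alpha> \<theta> \<longleftrightarrow>
     (\<exists>s. is_S_scale \<rho>1 b H s \<and> (\<forall>\<alpha>' \<theta>'. risk \<rho>2 H \<alpha> \<theta> s \<le> risk \<rho>2 H \<alpha>' \<theta>' s))"

text \<open>
  A slope functional selects the slope component of some solution wherever there is one and is
  undefined elsewhere; no uniqueness of the solution is presupposed.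
\<close>

definition S_slopes :: "(real \<Rightarrow> real) \<Rightarrow> real
    \<Rightarrow> ((real \<times> (real ^ 'p)) measure \<Rightarrow> (real ^ 'p) option) \<Rightarrow> bool" where
  "S_slopes \<rho> b T \<longleftrightarrow> (\<forall>H \<in> prob_measures. case T H of
       Some \<theta> \<Rightarrow> \<exists>\<alpha> \<sigma>. S_solution \<rho> b H \<alpha> \<theta> \<sigma>
     | None \<Rightarrow> \<nexists>\<alpha> \<theta> \<sigma>. S_solution \<rho> b H \<alpha> \<theta> \<sigma>)"

definition MM_slopes :: "(real \<Rightarrow> real) \<Rightarrow> (real \<Rightarrow> real) \<Rightarrow> real
    \<Rightarrow> ((real \<times> (real ^ 'p)) measure \<Rightarrow> (real ^ 'p) option) \<Rightarrow> bool" where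
  "MM_slopes \<rho>1 \<rho>2 b T \<longleftrightarrow> (\<forall>H \<in> prob_measures. case T H of
       Some \<theta> \<Rightarrow> \<exists>\<alpha>. MM_solution \<rho>1 \<rho>2 b H \<alpha> \<theta>
     | None \<Rightarrow> \<nexists>\<alpha> \<theta>. MM_solution \<rho>1 \<rho>2 b H \<alpha> \<theta>)"


subsection \<open>Auxiliary functions\<close>

text \<open>
  The \<open>itself\<close> arguments carry the dimension \<open>p\<close>, which does not occur in the result types.
\<close>

definition max_S_scale :: "'p::finite itself \<Rightarrow> (real \<Rightarrow> real) \<Rightarrow> real \<Rightarrow> real \<Rightarrow> real" where
  "max_S_scale _ \<rho> b \<epsilon> = Sup {s. \<exists>H \<in> (contam \<epsilon> :: (real \<times> (real ^ 'p)) measure set). is_S_scale \<rho> b H s}"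

definition h1 :: "'p::finite itself \<Rightarrow> (real \<Rightarrow> real) \<Rightarrow> real \<Rightarrow> real \<Rightarrow> real" where
  "h1 _ \<rho>2 s t =
     (INF \<theta> \<in> {\<theta> :: real ^ 'p. norm \<theta> = t}. INF \<alpha>. risk \<rho>2 Ho \<alpha> \<theta> s)
       - risk \<rho>2 (Ho :: (real \<times> (real ^ 'p)) measure) 0 0 s"

definition g_of :: "(real \<Rightarrow> real) \<Rightarrow> real \<Rightarrow> real" where
  "g_of \<rho> s = (\<integral>z. \<rho> (z / s) \<partial>std_normal_distribution)"

definition g_inv :: "(real \<Rightarrow> real) \<Rightarrow> real \<Rightarrow> real" where
  "g_inv \<rho> = inv_into {0<..} (g_of \<rho>)"

text \<open>
  \<open>sigma_be\<close> and \<open>gamma_be\<close> are \<open>\<sigma>\<^sub>b\<^sub>,\<^sub>\<epsilon>\<close> and \<open>\<gamma>\<^sub>b\<^sub>,\<^sub>\<epsilon>\<close>;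
  with \<open>s\<close> one of them, \<open>bias_bound\<close> is \<open>\<ell>(\<epsilon>)\<close> and \<open>u(\<epsilon>)\<close>, respectively.
\<close>

definition sigma_be :: "(real \<Rightarrow> real) \<Rightarrow> real \<Rightarrow> real \<Rightarrow> real" where
  "sigma_be \<rho>1 b \<epsilon> = g_inv \<rho>1 ((b - \<epsilon>) / (1 - \<epsilon>))"

definition gamma_be :: "(real \<Rightarrow> real) \<Rightarrow> real \<Rightarrow> real \<Rightarrow> real" where
  "gamma_be \<rho>1 b \<epsilon> = g_inv \<rho>1 (b / (1 - \<epsilon>))"

definition bias_bound :: "(real \<Rightarrow> real) \<Rightarrow> real \<Rightarrow> real \<Rightarrow> real" where
  "bias_bound \<rho>2 \<epsilon> s = sqrt ((s / g_inv \<rho>2 (g_of \<rho>2 s + \<epsilon> / (1 - \<epsilon>)))\<^sup>2 - 1)"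

end

theory Submission
  imports Defs
begin

text \<open>
  Under \<open>H\<^sub>o\<close> the residual of \<open>(\<alpha>, \<theta>)\<close> is \<open>N(- \<alpha>, 1 + \<parallel>\<theta>\<parallel>\<^sup>2)\<close>, so by Anderson's inequality its risk at scale \<open>s\<close>
  is at least \<open>g (s / R)\<close> with \<open>R\<^sup>2 = 1 + \<parallel>\<theta>\<parallel>\<^sup>2\<close>.  For \<open>H \<in> V\<^sub>\<epsilon>\<close> this confines the S-scale to
  \<open>[\<gamma>, \<sigma>]\<close>, and comparison of an MM-solution with the zero fit gives
  \<open>g\<^sub>2 (s / R) - g\<^sub>2 s \<le> \<epsilon> / (1 - \<epsilon>)\<close>.  By unimodality the left side is, as a function of \<open>s\<close>, at least
  the smaller of its values at the end points \<open>\<gamma>\<close> and \<open>\<sigma>\<close>, which is the upper bound.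

  For the lower bound suppose that the S- and MM-biases are at most \<open>t < \<ell>(\<epsilon>)\<close> and take \<open>t < r < \<ell>(\<epsilon>)\<close>.
  Point masses running to infinity along a line of slope \<open>r\<close> cannot be fitted with slopes of norm at
  most \<open>t\<close>.  This forces the S-scale towards \<open>\<sigma>\<close> and then makes the fit of slope \<open>r\<close>, which passes
  through the contaminating point, strictly better than the MM-solution.  The same contamination
  shows that the supremum of the S-scales is \<open>\<sigma>\<close>, so the hypothesis on the S-estimate says that its
  maximum bias is less than \<open>\<ell>(\<epsilon>)\<close>.
\<close>

subsection \<open>Linear functionals of a standard Gaussian vector\<close>

lemma sets_std_gaussian [simp, measurable_cong]: "sets std_gaussian = sets borel"
  by (simp add: std_gaussian_def)

lemma space_std_gaussian [simp]: "space std_gaussian = UNIV"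
  by (simp add: std_gaussian_def)

lemma prob_space_std_normal: "prob_space std_normal_distribution"
  by (rule prob_space_normal_density) simp

lemma emeasure_std_gaussian_box:
  fixes A :: "'a::euclidean_space \<Rightarrow> real set"
  assumes A [measurable]: "\<And>b. b \<in> Basis \<Longrightarrow> A b \<in> sets borel"
  shows "emeasure std_gaussian {z. \<forall>b\<in>Basis. z \<bullet> b \<in> A b}
    = (\<Prod>b\<in>Basis. emeasure std_normal_distribution (A b))"
proof -
  have [measurable]: "{z. \<forall>b\<in>Basis. z \<bullet> b \<in> A b} \<in> sets (borel :: 'a measure)"
  proof -
    have "{z. \<forall>b\<in>Basis. z \<bullet> b \<in> A b} = (\<Inter>b\<in>Basis. (\<lambda>z. z \<bullet> b) -` A b \<inter> space borel)"
      by auto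
    moreover have "(\<lambda>z. z \<bullet> b) -` A b \<inter> space borel \<in> sets (borel :: 'a measure)"
      if "b \<in> Basis" for b
      using A[OF that] by measurable
    ultimately show ?thesis
      by (auto intro!: sets.finite_INT)
  qed
  have *: "(\<Prod>b\<in>Basis. ennreal (std_normal_density (z \<bullet> b)) * indicator (A b) (z \<bullet> b))
      = ennreal (\<Prod>b\<in>Basis. std_normal_density (z \<bullet> b)) * indicator {z. \<forall>b\<in>Basis. z \<bullet> b \<in> A b} z"
    for z :: 'a
    by (auto simp: prod.distrib prod_ennreal indicator_def)
  have "emeasure std_gaussian {z. \<forall>b\<in>Basis. z \<bullet> b \<in> A b}
      = (\<integral>\<^sup>+z. (\<Prod>b\<in>Basis. ennreal (std_normal_density (z \<bullet> b)) * indicator (A b) (z \<bullet> b)) \<partial>lborel)"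
    unfolding std_gaussian_def by (subst emeasure_density) (simp_all add: *)
  also have "\<dots> = (\<Prod>b\<in>Basis. \<integral>\<^sup>+x. ennreal (std_normal_density x) * indicator (A b) x \<partial>lborel)"
    by (rule nn_integral_lborel_prod) auto
  also have "\<dots> = (\<Prod>b\<in>Basis. emeasure std_normal_distribution (A b))"
    using A by (intro prod.cong refl, subst emeasure_density) auto
  finally show ?thesis .
qed

lemma prob_space_std_gaussian: "prob_space (std_gaussian :: 'a::euclidean_space measure)"
proof
  have "emeasure std_normal_distribution UNIV = 1"
    using prob_space.emeasure_space_1[OF prob_space_std_normal] by simp
  then show "emeasure (std_gaussian :: 'a measure) (space std_gaussian) = 1"
    using emeasure_std_gaussian_box[of "\<lambda>_::'a. UNIV"] by simp
qed

lemma emeasure_std_gaussian_coord: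
  assumes A: "A \<in> sets borel" and b: "b \<in> Basis"
  shows "emeasure (std_gaussian :: 'a::euclidean_space measure) {z. z \<bullet> b \<in> A}
    = emeasure std_normal_distribution A"
proof -
  have "emeasure std_normal_distribution UNIV = 1"
    using prob_space.emeasure_space_1[OF prob_space_std_normal] by simp
  then have "(\<Prod>c\<in>Basis. emeasure std_normal_distribution (if c = b then A else UNIV))
      = emeasure std_normal_distribution A"
    using b by (simp add: if_distrib prod.delta cong: if_cong)
  moreover have "{z::'a. z \<bullet> b \<in> A} = {z. \<forall>c\<in>Basis. z \<bullet> c \<in> (if c = b then A else UNIV)}"
    using b by auto
  ultimately show ?thesis
    using emeasure_std_gaussian_box[of "\<lambda>c. if c = b then A else UNIV"] A by simp
qed

lemma distributed_std_gaussian_coord: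
  assumes b: "b \<in> Basis"
  shows "distributed (std_gaussian :: 'a::euclidean_space measure) lborel (\<lambda>z. z \<bullet> b) std_normal_density"
  unfolding distributed_def
proof (intro conjI)
  show "distr std_gaussian lborel (\<lambda>z::'a. z \<bullet> b) = std_normal_distribution"
  proof (rule measure_eqI)
    fix A assume "A \<in> sets (distr std_gaussian lborel (\<lambda>z::'a. z \<bullet> b))"
    then have A [measurable]: "A \<in> sets borel" by simp
    have "emeasure (distr std_gaussian lborel (\<lambda>z::'a. z \<bullet> b)) A
        = emeasure std_gaussian ((\<lambda>z::'a. z \<bullet> b) -` A \<inter> space std_gaussian)"
      by (rule emeasure_distr) simp_all
    also have "(\<lambda>z::'a. z \<bullet> b) -` A \<inter> space std_gaussian = {z. z \<bullet> b \<in> A}"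
      by auto
    finally show "emeasure (distr std_gaussian lborel (\<lambda>z::'a. z \<bullet> b)) A
        = emeasure std_normal_distribution A"
      using emeasure_std_gaussian_coord[OF A b] by simp
  qed simp
qed simp_all

lemma indep_vars_std_gaussian_coord:
  "prob_space.indep_vars (std_gaussian :: 'a::euclidean_space measure) (\<lambda>_. borel) (\<lambda>b z. z \<bullet> b) Basis"
proof -
  interpret prob_space "std_gaussian :: 'a measure" by (rule prob_space_std_gaussian)
  show ?thesis
  proof (subst indep_vars_finite[where E = "\<lambda>_. sets borel"])
    show "\<forall>A\<in>Basis \<rightarrow> sets borel.
        prob (\<Inter>b\<in>Basis. (\<lambda>z::'a. z \<bullet> b) -` A b \<inter> space std_gaussian)
        = (\<Prod>b\<in>Basis. prob ((\<lambda>z. z \<bullet> b) -` A b \<inter> space std_gaussian))"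
    proof
      fix A :: "'a \<Rightarrow> real set" assume "A \<in> Basis \<rightarrow> sets borel"
      then have A: "A b \<in> sets borel" if "b \<in> Basis" for b using that by auto
      have eq: "(\<lambda>z::'a. z \<bullet> b) -` A b \<inter> space std_gaussian = {z. z \<bullet> b \<in> A b}" for b
        by auto
      have "(\<Inter>b\<in>Basis. {z::'a. z \<bullet> b \<in> A b}) = {z. \<forall>b\<in>Basis. z \<bullet> b \<in> A b}"
        by auto
      moreover have "emeasure std_gaussian {z::'a. z \<bullet> b \<in> A b} = emeasure std_normal_distribution (A b)"
        if "b \<in> Basis" for b
        using emeasure_std_gaussian_coord[OF A[OF that] that] .
      ultimately have "emeasure std_gaussian (\<Inter>b\<in>Basis. {z::'a. z \<bullet> b \<in> A b})
          = (\<Prod>b\<in>Basis. emeasure std_gaussian {z::'a. z \<bullet> b \<in> A b})"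
        using emeasure_std_gaussian_box[OF A] by simp
      then have "ennreal (prob (\<Inter>b\<in>Basis. {z::'a. z \<bullet> b \<in> A b}))
          = ennreal (\<Prod>b\<in>Basis. prob {z::'a. z \<bullet> b \<in> A b})"
        by (simp add: emeasure_eq_measure prod_ennreal)
      then show "prob (\<Inter>b\<in>Basis. (\<lambda>z::'a. z \<bullet> b) -` A b \<inter> space std_gaussian)
        = (\<Prod>b\<in>Basis. prob ((\<lambda>z. z \<bullet> b) -` A b \<inter> space std_gaussian))"
        unfolding eq by (simp add: prod_nonneg)
    qed
  qed (auto simp: Int_stable_def sets.sigma_sets_eq[of borel, simplified])
qed

lemma distributed_std_gaussian_inner:
  fixes v :: "'a::euclidean_space"
  assumes v: "v \<noteq> 0"
  shows "distributed std_gaussian lborel (\<lambda>z. z \<bullet> v) (normal_density 0 (norm v))"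
proof -
  interpret prob_space "std_gaussian :: 'a measure" by (rule prob_space_std_gaussian)
  define I where "I = {b \<in> Basis. v \<bullet> b \<noteq> 0}"
  have fin: "finite I" and sub: "I \<subseteq> Basis" by (auto simp: I_def)
  have ne: "I \<noteq> {}"
    using v euclidean_all_zero_iff[of v] by (auto simp: I_def)
  have indep: "indep_vars (\<lambda>_. borel) (\<lambda>b z. v \<bullet> b * (z \<bullet> b)) I"
    using indep_vars_compose2[OF indep_vars_subset[OF indep_vars_std_gaussian_coord sub],
        of "\<lambda>b x. v \<bullet> b * x" "\<lambda>_. borel"] by simp
  have dist: "distributed std_gaussian lborel (\<lambda>z. v \<bullet> b * (z \<bullet> b)) (normal_density 0 \<bar>v \<bullet> b\<bar>)"
    if "b \<in> I" for b
    using normal_density_affine[OF distributed_std_gaussian_coord, of b "v \<bullet> b" 0] that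
    by (simp add: I_def)
  have "distributed std_gaussian lborel (\<lambda>z. \<Sum>b\<in>I. v \<bullet> b * (z \<bullet> b))
      (normal_density (\<Sum>b\<in>I. 0) (sqrt (\<Sum>b\<in>I. \<bar>v \<bullet> b\<bar>\<^sup>2)))"
    by (rule sum_indep_normal[OF fin ne indep _ dist]) (auto simp: I_def)
  moreover have "(\<Sum>b\<in>I. v \<bullet> b * (z \<bullet> b)) = z \<bullet> v" for z
    unfolding I_def euclidean_inner[of z v]
    by (rule sum.mono_neutral_cong_left) (auto simp: mult.commute)
  moreover have "sqrt (\<Sum>b\<in>I. \<bar>v \<bullet> b\<bar>\<^sup>2) = norm v"
    unfolding norm_eq_sqrt_inner euclidean_inner[of v v] I_def
    by (intro arg_cong[where f = sqrt] sum.mono_neutral_cong_left) (auto simp: power2_eq_square)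
  ultimately show ?thesis by simp
qed

lemma integral_std_gaussian_inner:
  fixes v :: "'a::euclidean_space" and f :: "real \<Rightarrow> real"
  assumes v: "v \<noteq> 0" and f [measurable]: "f \<in> borel_measurable borel"
  shows "(\<integral>z. f (z \<bullet> v) \<partial>std_gaussian) = (\<integral>w. f (norm v * w) \<partial>std_normal_distribution)"
proof -
  interpret prob_space "std_gaussian :: 'a measure" by (rule prob_space_std_gaussian)
  have "distributed std_gaussian lborel (\<lambda>z. (z \<bullet> v - 0) / norm v) std_normal_density"
    using distributed_std_gaussian_inner[OF v] v
    by (subst normal_standard_normal_convert[symmetric]) auto
  then have d: "distr std_gaussian lborel (\<lambda>z. z \<bullet> v / norm v) = std_normal_distribution"
    by (simp add: distributed_def)
  have "(\<integral>w. f (norm v * w) \<partial>std_normal_distribution)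
      = (\<integral>z. f (norm v * (z \<bullet> v / norm v)) \<partial>std_gaussian)"
    unfolding d[symmetric] by (rule integral_distr) simp_all
  then show ?thesis using v by simp
qed

subsection \<open>Loss functions and their Gaussian means\<close>

lemma A3_nonneg: "cond_A3 \<rho> \<Longrightarrow> 0 \<le> \<rho> u"
  by (simp add: cond_A3_def)

lemma A3_zero: "cond_A3 \<rho> \<Longrightarrow> \<rho> 0 = 0"
  by (simp add: cond_A3_def)

lemma A3_minus: "cond_A3 \<rho> \<Longrightarrow> \<rho> (- u) = \<rho> u"
  by (simp add: cond_A3_def)

lemma A3_abs: "cond_A3 \<rho> \<Longrightarrow> \<rho> \<bar>u\<bar> = \<rho> u"
  by (simp add: A3_minus abs_if)

lemma A3_tendsto: "cond_A3 \<rho> \<Longrightarrow> (\<rho> \<longlongrightarrow> 1) at_top"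
  by (simp add: cond_A3_def)

lemma A3_mono:
  assumes "cond_A3 \<rho>" "\<bar>u\<bar> \<le> \<bar>v\<bar>"
  shows "\<rho> u \<le> \<rho> v"
proof -
  have "\<rho> \<bar>u\<bar> \<le> \<rho> \<bar>v\<bar>"
    using assms by (auto simp: cond_A3_def intro: mono_onD)
  then show ?thesis using assms by (simp add: A3_abs)
qed

lemma A3_le_1:
  assumes "cond_A3 \<rho>"
  shows "\<rho> u \<le> 1"
proof (rule tendsto_lowerbound[OF A3_tendsto[OF assms]])
  show "\<forall>\<^sub>F v in at_top. \<rho> u \<le> \<rho> v"
    using eventually_ge_at_top[of "\<bar>u\<bar>"]
    by eventually_elim (use assms in \<open>auto intro: A3_mono\<close>)
qed simp

lemma A3_measurable:
  assumes "cond_A3 \<rho>"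
  shows "\<rho> \<in> borel_measurable borel"
proof -
  have "mono (\<lambda>u. \<rho> (max 0 u))"
    by (intro monoI A3_mono[OF assms]) auto
  from borel_measurable_mono[OF this]
  have "(\<lambda>u. \<rho> (max 0 u)) \<in> borel_measurable borel" .
  from measurable_compose[OF _ this, of abs borel]
  have "(\<lambda>u. \<rho> (max 0 \<bar>u\<bar>)) \<in> borel_measurable borel" by simp
  then show ?thesis using assms by (simp add: A3_abs)
qed

lemma A3_integrable:
  assumes "cond_A3 \<rho>" "prob_space M" "f \<in> borel_measurable M"
  shows "integrable M (\<lambda>x. \<rho> (f x))"
proof -
  interpret prob_space M by fact
  show ?thesis
  proof (rule integrable_const_bound[where B = 1])
    show "(\<lambda>x. \<rho> (f x)) \<in> borel_measurable M"
      using measurable_compose[OF assms(3) A3_measurable[OF assms(1)]] .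
  qed (use A3_nonneg[OF assms(1)] A3_le_1[OF assms(1)] in simp)
qed

lemma A3_integrable_std_normal:
  assumes "cond_A3 \<rho>" "f \<in> borel_measurable borel"
  shows "integrable std_normal_distribution (\<lambda>x. \<rho> (f x))"
  by (rule A3_integrable[OF assms(1) prob_space_std_normal]) (use assms(2) in simp)

lemma g_of_antimono:
  assumes A3: "cond_A3 \<rho>" and "0 < s" "s \<le> s'"
  shows "g_of \<rho> s' \<le> g_of \<rho> s"
  unfolding g_of_def
proof (rule integral_mono)
  show "\<rho> (z / s') \<le> \<rho> (z / s)" for z
    by (rule A3_mono[OF A3]) (use assms in \<open>auto simp: abs_divide intro!: divide_left_mono\<close>)
qed (auto intro!: A3_integrable_std_normal[OF A3])

lemma AE_std_normal_iff:
  "(AE z in std_normal_distribution. P z) \<longleftrightarrow> (AE z in lborel. P z)"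
  by (subst AE_density) (auto simp: normal_density_pos)

text \<open>A plateau of \<open>g_of \<rho>\<close> would make \<open>\<rho>\<close> almost everywhere invariant under a dilation, which
  contradicts an increase of \<open>\<rho>\<close> across an interval of the form \<open>[q v, v]\<close>.\<close>

lemma g_of_strict_antimono:
  assumes A3: "cond_A3 \<rho>" and u: "u > 0" "\<rho> u < 1" and s: "0 < s" "s < s'"
  shows "g_of \<rho> s' < g_of \<rho> s"
proof -
  define q where "q = sqrt (s' / s)"
  have q: "q > 1" using s by (simp add: q_def)
  have "\<exists>k. \<rho> (u * q ^ k) < \<rho> (u * q ^ Suc k)"
  proof (rule ccontr)
    assume "\<not> ?thesis"
    then have "\<rho> (u * q ^ Suc k) \<le> \<rho> (u * q ^ k)" for k by (simp add: not_less)
    then have le: "\<rho> (u * q ^ k) \<le> \<rho> u" for k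
      by (induction k) (auto intro: order_trans)
    have "filterlim (\<lambda>k. u * q ^ k) at_top sequentially"
      using u(1) q by real_asymp
    then have "(\<lambda>k. \<rho> (u * q ^ k)) \<longlonglongrightarrow> 1"
      using A3_tendsto[OF A3] by (rule filterlim_compose[rotated])
    then have "1 \<le> \<rho> u"
      by (rule tendsto_upperbound) (use le in auto)
    with u show False by simp
  qed
  then obtain k where k: "\<rho> (u * q ^ k) < \<rho> (u * q ^ Suc k)" ..
  define v where "v = u * q ^ k"
  have v: "v > 0" and k: "\<rho> v < \<rho> (v * q)"
    using u q k by (auto simp: v_def mult_ac)
  have "g_of \<rho> s \<noteq> g_of \<rho> s'"
  proof
    assume eq: "g_of \<rho> s = g_of \<rho> s'"
    have int: "integrable std_normal_distribution (\<lambda>z. \<rho> (z / c))" for c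
      by (rule A3_integrable_std_normal[OF A3]) simp
    have le: "\<rho> (z / s') \<le> \<rho> (z / s)" for z
      by (rule A3_mono[OF A3]) (use s in \<open>auto simp: abs_divide intro!: divide_left_mono\<close>)
    have "(\<integral>z. \<rho> (z / s) - \<rho> (z / s') \<partial>std_normal_distribution) = 0"
      using eq by (simp add: g_of_def int)
    then have "AE z in std_normal_distribution. \<rho> (z / s) - \<rho> (z / s') = 0"
      by (subst (asm) integral_nonneg_eq_0_iff_AE) (use int le in auto)
    then have "AE z in lborel. \<rho> (z / s) = \<rho> (z / s')"
      by (simp add: AE_std_normal_iff)
    moreover have "\<rho> (z / s) \<noteq> \<rho> (z / s')" if "z \<in> {s * v * q<..<s' * v}" for z
    proof -
      have z: "s * v * q < z" "z < s' * v" using that by auto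
      have "0 < s * v * q" using s v q by simp
      with z have "0 < z" by linarith
      with z have "\<rho> (z / s') \<le> \<rho> v" "\<rho> (v * q) \<le> \<rho> (z / s)"
        using s v q by (auto intro!: A3_mono[OF A3] simp: field_simps abs_mult)
      with k show ?thesis by linarith
    qed
    ultimately have "AE z in lborel. z \<notin> {s * v * q<..<s' * v}"
      by (auto elim!: eventually_mono)
    then have "emeasure lborel {s * v * q<..<s' * v} = 0"
      by (subst (asm) AE_iff_measurable[where N = "{s * v * q<..<s' * v}"]) auto
    moreover have "s * v * q < s' * v"
    proof -
      have "q * q = s' / s" using s by (simp add: q_def)
      then have "s' * v = s * v * q * q" using s by (simp add: mult.assoc)
      moreover have "s * v * q * 1 < s * v * q * q"
        using s v q by (intro mult_strict_left_mono) simp_all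
      ultimately show ?thesis by linarith
    qed
    ultimately show False by (simp add: ennreal_eq_0_iff)
  qed
  with g_of_antimono[OF A3, of s s'] s show ?thesis by simp
qed

lemma integral_rho_tendsto_1:
  assumes A3: "cond_A3 \<rho>" and f: "AE x in std_normal_distribution. filterlim (\<lambda>a. f a x) at_top at_top"
    and [measurable]: "\<And>a. f a \<in> borel_measurable borel"
  shows "((\<lambda>a. \<integral>x. \<rho> (f a x) \<partial>std_normal_distribution) \<longlongrightarrow> 1) (at_top :: real filter)"
proof -
  interpret prob_space std_normal_distribution by (rule prob_space_std_normal)
  have "((\<lambda>a. \<integral>x. \<rho> (f a x) \<partial>std_normal_distribution)
      \<longlongrightarrow> (\<integral>x. 1 \<partial>std_normal_distribution)) at_top"
  proof (rule integral_dominated_convergence_at_top[where w = "\<lambda>_. 1"])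
    show "\<forall>\<^sub>F a in at_top. AE x in std_normal_distribution. norm (\<rho> (f a x)) \<le> 1"
      using A3_nonneg[OF A3] A3_le_1[OF A3] by simp
    show "AE x in std_normal_distribution. ((\<lambda>a. \<rho> (f a x)) \<longlongrightarrow> 1) at_top"
      using f by eventually_elim (rule filterlim_compose[OF A3_tendsto[OF A3]])
    show "(\<lambda>x. \<rho> (f a x)) \<in> borel_measurable std_normal_distribution" for a
      using A3_measurable[OF A3] by measurable
  qed simp_all
  then show ?thesis using prob_space by simp
qed

lemma g_of_tendsto_1:
  assumes A3: "cond_A3 \<rho>"
  shows "(g_of \<rho> \<longlongrightarrow> 1) (at_right 0)"
proof -
  have "((\<lambda>a. \<integral>x. \<rho> (a * \<bar>x\<bar>) \<partial>std_normal_distribution) \<longlongrightarrow> 1) at_top"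
  proof (rule integral_rho_tendsto_1[OF A3])
    have "filterlim (\<lambda>a. a * \<bar>x\<bar>) at_top at_top" if "x \<noteq> 0" for x :: real
      using that by (intro filterlim_at_top_mult_tendsto_pos[of _ "\<bar>x\<bar>"] filterlim_ident) auto
    then show "AE x in std_normal_distribution. filterlim (\<lambda>a. a * \<bar>x\<bar>) at_top at_top"
      using AE_lborel_singleton[of "0::real"]
      by (auto simp: AE_std_normal_iff elim!: eventually_mono)
  qed simp
  then have "((\<lambda>s. \<integral>x. \<rho> (inverse s * \<bar>x\<bar>) \<partial>std_normal_distribution) \<longlongrightarrow> 1) (at_right 0)"
    by (rule filterlim_compose[OF _ filterlim_inverse_at_top_right])
  then show ?thesis
  proof (rule Lim_transform_eventually)
    show "\<forall>\<^sub>F s in at_right 0. (\<integral>x. \<rho> (inverse s * \<bar>x\<bar>) \<partial>std_normal_distribution) = g_of \<rho> s"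
      using eventually_at_right_less[of 0]
    proof eventually_elim
      case (elim s)
      have "\<rho> (inverse s * \<bar>x\<bar>) = \<rho> (x / s)" for x
        using A3_abs[OF A3, of "inverse s * x"] elim by (simp add: abs_mult divide_inverse mult.commute)
      then show ?case by (simp add: g_of_def)
    qed
  qed
qed

lemma g_of_A4_continuous:
  assumes "cond_A4 g"
  shows "continuous_on {0<..} g"
  using assms by (auto simp: cond_A4_def intro: C1_differentiable_imp_continuous_on)

lemma g_inv_correct:
  assumes A3: "cond_A3 \<rho>" and cont: "continuous_on {0<..} (g_of \<rho>)"
    and s: "s > 0" and e: "e \<ge> 0" "g_of \<rho> s + e < 1"
  shows "0 < g_inv \<rho> (g_of \<rho> s + e)" "g_of \<rho> (g_inv \<rho> (g_of \<rho> s + e)) = g_of \<rho> s + e"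
proof -
  have "\<forall>\<^sub>F r in at_right 0. g_of \<rho> s + e < g_of \<rho> r"
    using g_of_tendsto_1[OF A3] e(2) by (rule order_tendstoD(1))
  moreover have "\<forall>\<^sub>F r in at_right 0. r \<in> {0<..<s}"
    using eventually_at_right_real[OF s] .
  ultimately have "\<forall>\<^sub>F r in at_right 0. g_of \<rho> s + e < g_of \<rho> r \<and> r \<in> {0<..<s}"
    by (rule eventually_conj)
  then obtain r where r: "g_of \<rho> s + e < g_of \<rho> r" "0 < r" "r < s"
    using eventually_happens'[of "at_right (0::real)"] by auto
  have "\<exists>x\<ge>r. x \<le> s \<and> g_of \<rho> x = g_of \<rho> s + e"
    by (rule IVT2') (use r e in \<open>auto intro: continuous_on_subset[OF cont]\<close>)
  then obtain x where x: "r \<le> x" "g_of \<rho> x = g_of \<rho> s + e" by blast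
  have img: "g_of \<rho> s + e \<in> g_of \<rho> ` {0<..}"
    by (rule image_eqI[of _ _ x]) (use x r in auto)
  show "0 < g_inv \<rho> (g_of \<rho> s + e)"
    using inv_into_into[OF img] by (simp add: g_inv_def)
  show "g_of \<rho> (g_inv \<rho> (g_of \<rho> s + e)) = g_of \<rho> s + e"
    unfolding g_inv_def by (rule f_inv_into_f[OF img])
qed

text \<open>Anderson's inequality: after recentring at the midpoint of the shift, the increment of the loss
  is odd and has the sign of its argument, and so has, with the opposite sign, the increment of the
  density.\<close>

lemma integral_rho_shift_ge:
  assumes A3: "cond_A3 \<rho>" and s: "s > 0"
  shows "g_of \<rho> s \<le> (\<integral>z. \<rho> (z / s - a) \<partial>std_normal_distribution)"
proof -
  define h where "h = s * a / 2"
  define D where "D w = \<rho> ((w - h) / s) - \<rho> ((w + h) / s)" for w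
  define F where "F w = std_normal_density (w + h) * D w" for w
  note [measurable] = A3_measurable[OF A3]
  have int: "integrable lborel (\<lambda>z. std_normal_density z * \<rho> (z / s - c))" for c
  proof -
    have "integrable std_normal_distribution (\<lambda>z. \<rho> (z / s - c))"
      by (rule A3_integrable_std_normal[OF A3]) simp
    then show ?thesis
      by (subst (asm) integrable_density) (auto simp: normal_density_nonneg)
  qed
  define G where "G z = std_normal_density z * (\<rho> (z / s - a) - \<rho> (z / s - 0))" for z
  have intG: "integrable lborel G"
    unfolding G_def right_diff_distrib by (intro Bochner_Integration.integrable_diff int)
  have FG: "F w = G (h + 1 * w)" for w
  proof -
    have "(h + w) / s - a = (w - h) / s" using s by (simp add: h_def field_simps)
    then show ?thesis by (simp add: F_def D_def G_def add.commute)
  qed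
  have intF: "integrable lborel F"
    unfolding FG[abs_def] by (rule lborel_integrable_real_affine[OF intG]) simp
  have sign: "F w + F (- w) \<ge> 0" for w
  proof -
    have "\<rho> ((- w - h) / s) = \<rho> ((w + h) / s)" "\<rho> ((- w + h) / s) = \<rho> ((w - h) / s)"
      using A3_minus[OF A3, of "(w + h) / s"] A3_minus[OF A3, of "(w - h) / s"]
      by (simp_all add: minus_divide_left)
    then have "D (- w) = - D w" by (simp add: D_def)
    moreover have "std_normal_density (- w + h) = std_normal_density (w - h)"
      by (simp add: std_normal_density_def power2_commute)
    ultimately have eq: "F w + F (- w) = (std_normal_density (w + h) - std_normal_density (w - h)) * D w"
      by (simp add: F_def algebra_simps)
    show ?thesis
    proof (cases "\<bar>w + h\<bar> \<le> \<bar>w - h\<bar>")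
      case True
      then have "(w + h)\<^sup>2 \<le> (w - h)\<^sup>2" by (simp add: abs_le_square_iff)
      then have "std_normal_density (w - h) \<le> std_normal_density (w + h)"
        by (simp add: std_normal_density_def divide_right_mono)
      moreover have "D w \<ge> 0"
        using A3_mono[OF A3, of "(w + h) / s" "(w - h) / s"] s True
        by (simp add: D_def abs_divide divide_right_mono)
      ultimately show ?thesis by (simp add: eq)
    next
      case False
      then have "(w - h)\<^sup>2 \<le> (w + h)\<^sup>2" by (simp add: abs_le_square_iff[symmetric])
      then have "std_normal_density (w + h) \<le> std_normal_density (w - h)"
        by (simp add: std_normal_density_def divide_right_mono)
      moreover have "D w \<le> 0"
        using A3_mono[OF A3, of "(w - h) / s" "(w + h) / s"] s False
        by (simp add: D_def abs_divide divide_right_mono)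
      ultimately show ?thesis by (simp add: eq mult_nonpos_nonpos)
    qed
  qed
  have eqm: "(\<integral>w. F (- w) \<partial>lborel) = (\<integral>w. F w \<partial>lborel)"
    using lborel_integral_real_affine[of "-1" F 0] by simp
  have intm: "integrable lborel (\<lambda>w. F (- w))"
    using lborel_integrable_real_affine[OF intF, of "-1" 0] by simp
  have "0 \<le> (\<integral>w. F w + F (- w) \<partial>lborel)"
    using sign by (intro Bochner_Integration.integral_nonneg) auto
  also have "\<dots> = 2 * (\<integral>w. F w \<partial>lborel)"
    by (simp add: Bochner_Integration.integral_add[OF intF intm] eqm)
  finally have "0 \<le> (\<integral>w. F w \<partial>lborel)" by simp
  also have "\<dots> = (\<integral>z. G z \<partial>lborel)"
    using lborel_integral_real_affine[of 1 G h] by (simp add: FG)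
  also have "\<dots> = (\<integral>z. std_normal_density z * \<rho> (z / s - a) \<partial>lborel)
      - (\<integral>z. std_normal_density z * \<rho> (z / s - 0) \<partial>lborel)"
    unfolding G_def right_diff_distrib by (rule Bochner_Integration.integral_diff[OF int int])
  also have "\<dots> = (\<integral>z. \<rho> (z / s - a) \<partial>std_normal_distribution) - g_of \<rho> s"
    unfolding g_of_def by (simp add: integral_density normal_density_nonneg)
  finally show ?thesis by simp
qed

subsection \<open>Risks at contaminated distributions\<close>

definition mixture :: "real \<Rightarrow> 'a measure \<Rightarrow> 'a measure \<Rightarrow> 'a measure" where
  "mixture \<epsilon> M N = measure_pmf (bernoulli_pmf \<epsilon>) \<bind> (\<lambda>c. if c then N else M)"

context
  fixes \<epsilon> :: real and M N :: "'a::topological_space measure"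
  assumes eps: "0 < \<epsilon>" "\<epsilon> < 1" and M: "M \<in> prob_measures" and N: "N \<in> prob_measures"
begin

lemma mixture_kernel:
  "(\<lambda>c. if c then N else M) \<in> measure_pmf (bernoulli_pmf \<epsilon>) \<rightarrow>\<^sub>M subprob_algebra borel"
  using M N by (auto simp: prob_measures_def space_subprob_algebra prob_space_imp_subprob_space)

lemma sets_mixture [simp]: "sets (mixture \<epsilon> M N) = sets borel"
  unfolding mixture_def by (rule sets_bind) (use M N in \<open>auto simp: prob_measures_def\<close>)

lemma nn_integral_mixture:
  assumes "f \<in> borel_measurable borel"
  shows "(\<integral>\<^sup>+x. f x \<partial>mixture \<epsilon> M N) = (1 - \<epsilon>) * (\<integral>\<^sup>+x. f x \<partial>M) + \<epsilon> * (\<integral>\<^sup>+x. f x \<partial>N)"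
  unfolding mixture_def
  by (subst nn_integral_bind[OF assms mixture_kernel]) (use eps in \<open>simp add: mult.commute add.commute\<close>)

lemma emeasure_mixture:
  assumes "A \<in> sets borel"
  shows "emeasure (mixture \<epsilon> M N) A = ennreal ((1 - \<epsilon>) * measure M A + \<epsilon> * measure N A)"
proof -
  interpret M: prob_space M using M by (simp add: prob_measures_def)
  interpret N: prob_space N using N by (simp add: prob_measures_def)
  have A: "A \<in> sets M" "A \<in> sets N" "A \<in> sets (mixture \<epsilon> M N)"
    using assms M N by (simp_all add: prob_measures_def)
  have "emeasure (mixture \<epsilon> M N) A = (1 - \<epsilon>) * emeasure M A + \<epsilon> * emeasure N A"
    using nn_integral_mixture[of "indicator A"] A assms by simp
  then show ?thesis
    using eps by (simp add: M.emeasure_eq_measure N.emeasure_eq_measure ennreal_mult ennreal_plus)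
qed

lemma measure_mixture:
  "A \<in> sets borel \<Longrightarrow> measure (mixture \<epsilon> M N) A = (1 - \<epsilon>) * measure M A + \<epsilon> * measure N A"
  unfolding measure_def[of "mixture \<epsilon> M N"]
  by (subst emeasure_mixture, assumption, rule enn2real_ennreal) (use eps in simp)

lemma mixture_in_prob_measures: "mixture \<epsilon> M N \<in> prob_measures"
proof -
  have sp: "space M = UNIV" "space N = UNIV" "space (mixture \<epsilon> M N) = UNIV"
    using M N sets_eq_imp_space_eq[OF sets_mixture]
    by (auto simp: prob_measures_def dest!: sets_eq_imp_space_eq)
  have "measure M UNIV = 1" "measure N UNIV = 1"
    using M N prob_space.prob_space[of M] prob_space.prob_space[of N] sp
    by (auto simp: prob_measures_def)
  then have "emeasure (mixture \<epsilon> M N) (space (mixture \<epsilon> M N)) = 1"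
    unfolding sp by (subst emeasure_mixture) auto
  then show ?thesis by (auto simp: prob_measures_def intro: prob_spaceI)
qed

lemma eq_mixture:
  assumes H: "H \<in> prob_measures"
    and eq: "\<And>A. A \<in> sets borel \<Longrightarrow> measure H A = (1 - \<epsilon>) * measure M A + \<epsilon> * measure N A"
  shows "H = mixture \<epsilon> M N"
proof (rule measure_eqI)
  interpret prob_space H using H by (simp add: prob_measures_def)
  show "sets H = sets (mixture \<epsilon> M N)"
    using H by (simp add: prob_measures_def)
  fix A assume "A \<in> sets H"
  then have "A \<in> sets borel" using H by (simp add: prob_measures_def)
  then show "emeasure H A = emeasure (mixture \<epsilon> M N) A"
    by (simp add: emeasure_mixture eq emeasure_eq_measure)
qed

lemma integral_mixture:
  fixes f :: "'a \<Rightarrow> real"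
  assumes f [measurable]: "f \<in> borel_measurable borel" and bd: "\<And>x. 0 \<le> f x" "\<And>x. f x \<le> 1"
  shows "(\<integral>x. f x \<partial>mixture \<epsilon> M N) = (1 - \<epsilon>) * (\<integral>x. f x \<partial>M) + \<epsilon> * (\<integral>x. f x \<partial>N)"
proof -
  have int: "integrable P f" if "P \<in> prob_measures" for P
  proof -
    interpret prob_space P using that by (simp add: prob_measures_def)
    have [measurable_cong]: "sets P = sets borel" using that by (simp add: prob_measures_def)
    show ?thesis
      by (rule integrable_const_bound[where B = 1]) (use bd in auto)
  qed
  have nn: "(\<integral>\<^sup>+x. ennreal (f x) \<partial>P) = ennreal (\<integral>x. f x \<partial>P)" if "P \<in> prob_measures" for P
    by (rule nn_integral_eq_integral[OF int[OF that]]) (use bd in auto)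
  have nonneg: "0 \<le> (\<integral>x. f x \<partial>P)" for P :: "'a measure"
    by (rule Bochner_Integration.integral_nonneg) (use bd in auto)
  have "ennreal (\<integral>x. f x \<partial>mixture \<epsilon> M N) = ennreal (1 - \<epsilon>) * ennreal (\<integral>x. f x \<partial>M) + ennreal \<epsilon> * ennreal (\<integral>x. f x \<partial>N)"
    using nn_integral_mixture[of "\<lambda>x. ennreal (f x)"] by (simp add: nn M N mixture_in_prob_measures)
  also have "\<dots> = ennreal ((1 - \<epsilon>) * (\<integral>x. f x \<partial>M) + \<epsilon> * (\<integral>x. f x \<partial>N))"
    using eps nonneg by (simp add: ennreal_mult ennreal_plus)
  finally show ?thesis
    using eps nonneg by (subst (asm) ennreal_inj) auto
qed

end

lemma Ho_in_prob_measures: "(Ho :: (real \<times> (real ^ 'p)) measure) \<in> prob_measures"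
  by (simp add: prob_measures_def prob_space_std_gaussian)

lemma risk_integrand_measurable:
  assumes "cond_A3 \<rho>"
  shows "(\<lambda>(y, x). \<rho> ((y - \<alpha> - x \<bullet> \<theta>) / s)) \<in> borel_measurable (borel :: (real \<times> (real ^ 'p)) measure)"
proof -
  note [measurable] = A3_measurable[OF assms]
  have [measurable]: "(\<lambda>z. \<theta> \<bullet> snd z) \<in> borel_measurable (borel :: (real \<times> (real ^ 'p)) measure)"
    by (intro borel_measurable_continuous_onI continuous_intros)
  have [measurable]: "(\<lambda>z. fst z) \<in> borel_measurable (borel :: (real \<times> (real ^ 'p)) measure)"
    by (intro borel_measurable_continuous_onI continuous_intros)
  show ?thesis
    unfolding case_prod_beta by (subst inner_commute) measurable
qed

lemma risk_mixture:
  fixes M N :: "(real \<times> (real ^ 'p)) measure"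
  assumes "cond_A3 \<rho>" "0 < \<epsilon>" "\<epsilon> < 1" "M \<in> prob_measures" "N \<in> prob_measures"
  shows "risk \<rho> (mixture \<epsilon> M N) \<alpha> \<theta> s = (1 - \<epsilon>) * risk \<rho> M \<alpha> \<theta> s + \<epsilon> * risk \<rho> N \<alpha> \<theta> s"
  unfolding risk_def
  by (rule integral_mixture[OF assms(2-5) risk_integrand_measurable[OF assms(1)]])
    (auto simp: A3_nonneg A3_le_1 assms)

lemma risk_bounds:
  fixes H :: "(real \<times> (real ^ 'p)) measure"
  assumes "cond_A3 \<rho>" "H \<in> prob_measures"
  shows "0 \<le> risk \<rho> H \<alpha> \<theta> s" "risk \<rho> H \<alpha> \<theta> s \<le> 1"
proof -
  interpret prob_space H using assms by (simp add: prob_measures_def)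
  have "(\<lambda>(y, x). \<rho> ((y - \<alpha> - x \<bullet> \<theta>) / s)) \<in> borel_measurable H"
    using risk_integrand_measurable[OF assms(1)] assms(2) by (simp add: prob_measures_def cong: measurable_cong_sets)
  then have int: "integrable H (\<lambda>(y, x). \<rho> ((y - \<alpha> - x \<bullet> \<theta>) / s))"
    by (intro integrable_const_bound[where B = 1]) (auto simp: A3_nonneg A3_le_1 assms)
  show "0 \<le> risk \<rho> H \<alpha> \<theta> s"
    unfolding risk_def by (rule Bochner_Integration.integral_nonneg) (auto simp: A3_nonneg assms)
  have "risk \<rho> H \<alpha> \<theta> s \<le> (\<integral>z. 1 \<partial>H)"
    unfolding risk_def by (rule integral_mono[OF int]) (auto simp: A3_le_1 assms)
  then show "risk \<rho> H \<alpha> \<theta> s \<le> 1" using prob_space by simp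
qed

definition resid_sd :: "real ^ 'p \<Rightarrow> real" where
  "resid_sd \<theta> = sqrt (1 + (norm \<theta>)\<^sup>2)"

lemma resid_sd_ge_1: "1 \<le> resid_sd \<theta>"
  by (simp add: resid_sd_def)

lemma resid_sd_pos [simp]: "0 < resid_sd \<theta>"
  using resid_sd_ge_1[of \<theta>] by linarith

lemma risk_Ho:
  fixes \<theta> :: "real ^ 'p"
  assumes A3: "cond_A3 \<rho>"
  shows "risk \<rho> Ho \<alpha> \<theta> s = (\<integral>z. \<rho> (z / (s / resid_sd \<theta>) - \<alpha> / s) \<partial>std_normal_distribution)"
proof -
  note [measurable] = A3_measurable[OF A3]
  have nrm: "norm (1 :: real, - \<theta>) = resid_sd \<theta>"
    by (simp add: norm_Pair resid_sd_def)
  have nz: "(1 :: real, - \<theta>) \<noteq> 0" by (simp add: zero_prod_def)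
  have meas: "(\<lambda>w. \<rho> ((w - \<alpha>) / s)) \<in> borel_measurable borel" by measurable
  have "risk \<rho> Ho \<alpha> \<theta> s = (\<integral>z. \<rho> ((z \<bullet> (1, - \<theta>) - \<alpha>) / s) \<partial>Ho)"
    unfolding risk_def by (rule Bochner_Integration.integral_cong) (auto simp: algebra_simps)
  also have "\<dots> = (\<integral>w. \<rho> ((resid_sd \<theta> * w - \<alpha>) / s) \<partial>std_normal_distribution)"
    unfolding integral_std_gaussian_inner[OF nz meas] nrm ..
  finally show ?thesis
    by (simp add: diff_divide_distrib mult.commute)
qed

lemma risk_Ho_0: "cond_A3 \<rho> \<Longrightarrow> risk \<rho> Ho 0 \<theta> s = g_of \<rho> (s / resid_sd \<theta>)"
  by (simp add: risk_Ho g_of_def)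

lemma risk_Ho_ge: "cond_A3 \<rho> \<Longrightarrow> s > 0 \<Longrightarrow> g_of \<rho> (s / resid_sd \<theta>) \<le> risk \<rho> Ho \<alpha> \<theta> s"
  unfolding risk_Ho by (rule integral_rho_shift_ge) simp_all

lemma contam_obtain:
  fixes H :: "(real \<times> (real ^ 'p)) measure"
  assumes H: "H \<in> contam \<epsilon>" and eps: "0 < \<epsilon>" "\<epsilon> < 1"
  obtains H' :: "(real \<times> (real ^ 'p)) measure" where "H' \<in> prob_measures"
    "\<And>\<rho> \<alpha> \<theta> s. cond_A3 \<rho> \<Longrightarrow> risk \<rho> H \<alpha> \<theta> s = (1 - \<epsilon>) * risk \<rho> Ho \<alpha> \<theta> s + \<epsilon> * risk \<rho> H' \<alpha> \<theta> s"
proof -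
  from H obtain H' :: "(real \<times> (real ^ 'p)) measure" where H': "H' \<in> prob_measures"
    and eq: "\<And>A. A \<in> sets borel \<Longrightarrow> measure H A = (1 - \<epsilon>) * measure Ho A + \<epsilon> * measure H' A"
    and HP: "H \<in> prob_measures"
    unfolding contam_def by blast
  have "H = mixture \<epsilon> Ho H'"
    by (rule eq_mixture[OF eps Ho_in_prob_measures H' HP eq])
  with H' eps show ?thesis
    by (intro that[OF H']) (simp add: risk_mixture Ho_in_prob_measures)
qed

lemma contam_risk_ge:
  fixes H :: "(real \<times> (real ^ 'p)) measure"
  assumes "H \<in> contam \<epsilon>" "0 < \<epsilon>" "\<epsilon> < 1" "cond_A3 \<rho>" "s > 0"
  shows "(1 - \<epsilon>) * g_of \<rho> (s / resid_sd \<theta>) \<le> risk \<rho> H \<alpha> \<theta> s"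
proof -
  obtain H' :: "(real \<times> (real ^ 'p)) measure" where H': "H' \<in> prob_measures"
    and eq: "\<And>\<rho> \<alpha> \<theta> s. cond_A3 \<rho> \<Longrightarrow> risk \<rho> H \<alpha> \<theta> s = (1 - \<epsilon>) * risk \<rho> Ho \<alpha> \<theta> s + \<epsilon> * risk \<rho> H' \<alpha> \<theta> s"
    by (rule contam_obtain[OF assms(1-3)]) blast
  have "(1 - \<epsilon>) * g_of \<rho> (s / resid_sd \<theta>) \<le> (1 - \<epsilon>) * risk \<rho> Ho \<alpha> \<theta> s"
    using assms by (intro mult_left_mono risk_Ho_ge) auto
  moreover have "0 \<le> \<epsilon> * risk \<rho> H' \<alpha> \<theta> s"
    using assms risk_bounds(1)[OF assms(4) H'] by simp
  ultimately show ?thesis using eq[OF assms(4)] by simp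
qed

lemma contam_risk_0_le:
  fixes H :: "(real \<times> (real ^ 'p)) measure"
  assumes "H \<in> contam \<epsilon>" "0 < \<epsilon>" "\<epsilon> < 1" "cond_A3 \<rho>"
  shows "risk \<rho> H 0 0 s \<le> (1 - \<epsilon>) * g_of \<rho> s + \<epsilon>"
proof -
  obtain H' :: "(real \<times> (real ^ 'p)) measure" where H': "H' \<in> prob_measures"
    and eq: "\<And>\<rho> \<alpha> \<theta> s. cond_A3 \<rho> \<Longrightarrow> risk \<rho> H \<alpha> \<theta> s = (1 - \<epsilon>) * risk \<rho> Ho \<alpha> \<theta> s + \<epsilon> * risk \<rho> H' \<alpha> \<theta> s"
    by (rule contam_obtain[OF assms(1-3)]) blast
  have "risk \<rho> Ho 0 (0 :: real ^ 'p) s = g_of \<rho> s"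
    by (simp add: risk_Ho_0[OF assms(4)] resid_sd_def)
  moreover have "\<epsilon> * risk \<rho> H' 0 0 s \<le> \<epsilon> * 1"
    using assms risk_bounds(2)[OF assms(4) H'] by (intro mult_left_mono) auto
  ultimately show ?thesis using eq[OF assms(4)] by simp
qed

definition point_contam :: "real \<Rightarrow> real \<times> (real ^ 'p) \<Rightarrow> (real \<times> (real ^ 'p)) measure" where
  "point_contam \<epsilon> z = mixture \<epsilon> Ho (return borel z)"

lemma return_in_prob_measures: "return borel z \<in> prob_measures"
  by (simp add: prob_measures_def prob_space_return)

lemma point_contam_in_contam:
  assumes "0 < \<epsilon>" "\<epsilon> < 1"
  shows "point_contam \<epsilon> z \<in> contam \<epsilon>"
  unfolding contam_def point_contam_def
  using mixture_in_prob_measures[OF assms Ho_in_prob_measures return_in_prob_measures]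
    measure_mixture[OF assms Ho_in_prob_measures return_in_prob_measures] return_in_prob_measures
  by blast

lemma risk_point_contam:
  assumes "cond_A3 \<rho>" "0 < \<epsilon>" "\<epsilon> < 1"
  shows "risk \<rho> (point_contam \<epsilon> (y, x)) \<alpha> \<theta> s
    = (1 - \<epsilon>) * risk \<rho> Ho \<alpha> \<theta> s + \<epsilon> * \<rho> ((y - \<alpha> - x \<bullet> \<theta>) / s)"
proof -
  have "risk \<rho> (return borel (y, x)) \<alpha> \<theta> s = \<rho> ((y - \<alpha> - x \<bullet> \<theta>) / s)"
    unfolding risk_def by (subst integral_return) (auto intro: risk_integrand_measurable[OF assms(1)])
  then show ?thesis
    unfolding point_contam_def
    by (simp add: risk_mixture[OF assms Ho_in_prob_measures return_in_prob_measures])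
qed

subsection \<open>Point contamination along a line\<close>

text \<open>An estimate whose slope stays away from that of the contaminating line either has an intercept
  so large that almost all of the central data have loss close to \<open>1\<close>, or does not fit the
  contaminating point.\<close>

lemma risk_point_contam_lower:
  fixes e :: "real ^ 'p"
  assumes A3: "cond_A3 \<rho>" and eps: "0 < \<epsilon>" "\<epsilon> < 1" and t: "t < r" and e: "norm e = 1"
    and S: "S > 0" and eta: "\<eta> > 0"
  shows "\<forall>\<^sub>F n in at_top. \<forall>\<alpha> \<theta> s. norm \<theta> \<le> t \<longrightarrow> 0 < s \<longrightarrow> s \<le> S \<longrightarrow>
    (1 - \<epsilon>) * (1 - \<eta>) \<le> risk \<rho> (point_contam \<epsilon> (n * r, n *\<^sub>R e)) \<alpha> \<theta> s \<or>
    (1 - \<epsilon>) * g_of \<rho> s + \<epsilon> * (1 - \<eta>) \<le> risk \<rho> (point_contam \<epsilon> (n * r, n *\<^sub>R e)) \<alpha> \<theta> s"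
proof -
  define R where "R = sqrt (1 + t\<^sup>2)"
  define f where "f a x = max 0 (a - R * \<bar>x\<bar>) / S" for a x
  note [measurable] = A3_measurable[OF A3]
  have fl: "filterlim (\<lambda>a. f a x) at_top at_top" for x
  proof -
    have "filterlim (\<lambda>a. (a - R * \<bar>x\<bar>) / S) at_top at_top"
      using S by real_asymp
    then show ?thesis
      by (rule filterlim_at_top_mono) (use S in \<open>simp add: f_def divide_right_mono\<close>)
  qed
  have fm [measurable]: "f a \<in> borel_measurable borel" for a
    unfolding f_def by measurable
  have "((\<lambda>a. \<integral>x. \<rho> (f a x) \<partial>std_normal_distribution) \<longlongrightarrow> 1) at_top"
    by (rule integral_rho_tendsto_1[OF A3]) (use fl in auto)
  then have "\<forall>\<^sub>F a in at_top. 1 - \<eta> < (\<integral>x. \<rho> (f a x) \<partial>std_normal_distribution)"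
    by (rule order_tendstoD) (use eta in auto)
  moreover have "((\<lambda>a. \<rho> (a / S)) \<longlongrightarrow> 1) at_top"
    by (rule filterlim_compose[OF A3_tendsto[OF A3]]) (use S in real_asymp)
  then have "\<forall>\<^sub>F a in at_top. 1 - \<eta> < \<rho> (a / S)"
    by (rule order_tendstoD) (use eta in auto)
  ultimately have "\<forall>\<^sub>F a in at_top. 1 - \<eta> < (\<integral>x. \<rho> (f a x) \<partial>std_normal_distribution)
      \<and> 1 - \<eta> < \<rho> (a / S) \<and> 0 < a"
    using eventually_gt_at_top[of 0] by eventually_elim auto
  then obtain a where a: "1 - \<eta> < (\<integral>x. \<rho> (f a x) \<partial>std_normal_distribution)"
      "1 - \<eta> < \<rho> (a / S)" "0 < a"
    using eventually_happens'[of "at_top :: real filter"] by auto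
  show ?thesis
    using eventually_ge_at_top[of "2 * a / (r - t)"]
  proof eventually_elim
    case (elim n)
    show ?case
    proof (intro allI impI)
      fix \<alpha> s :: real and \<theta> :: "real ^ 'p"
      assume \<theta>: "norm \<theta> \<le> t" and s: "0 < s" "s \<le> S"
      have n: "2 * a \<le> n * (r - t)" using elim t by (simp add: field_simps)
      with a(3) have "0 < n * (r - t)" by linarith
      with t have n0: "n > 0" by (simp add: zero_less_mult_iff)
      note eq = risk_point_contam[OF A3 eps, of "n * r" "n *\<^sub>R e" \<alpha> \<theta> s]
      show "(1 - \<epsilon>) * (1 - \<eta>) \<le> risk \<rho> (point_contam \<epsilon> (n * r, n *\<^sub>R e)) \<alpha> \<theta> s \<or>
        (1 - \<epsilon>) * g_of \<rho> s + \<epsilon> * (1 - \<eta>) \<le> risk \<rho> (point_contam \<epsilon> (n * r, n *\<^sub>R e)) \<alpha> \<theta> s"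
      proof (cases "\<bar>\<alpha>\<bar> \<ge> a")
        case True
        have RR: "resid_sd \<theta> \<le> R"
          using \<theta> by (simp add: resid_sd_def R_def power_mono)
        have "(\<integral>x. \<rho> (f a x) \<partial>std_normal_distribution) \<le> risk \<rho> Ho \<alpha> \<theta> s"
          unfolding risk_Ho[OF A3]
        proof (rule integral_mono)
          show "integrable std_normal_distribution (\<lambda>z. \<rho> (f a z))"
            by (rule A3_integrable_std_normal[OF A3]) simp
          show "integrable std_normal_distribution (\<lambda>z. \<rho> (z / (s / resid_sd \<theta>) - \<alpha> / s))"
            by (rule A3_integrable_std_normal[OF A3]) simp
          fix z :: real
          have "a - R * \<bar>z\<bar> \<le> \<bar>\<alpha>\<bar> - resid_sd \<theta> * \<bar>z\<bar>"
            using True RR by (intro diff_mono mult_right_mono) auto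
          also have "resid_sd \<theta> * \<bar>z\<bar> = \<bar>resid_sd \<theta> * z\<bar>"
            by (simp add: abs_mult abs_of_pos)
          also have "\<bar>\<alpha>\<bar> - \<bar>resid_sd \<theta> * z\<bar> \<le> \<bar>resid_sd \<theta> * z - \<alpha>\<bar>"
            by linarith
          finally have "max 0 (a - R * \<bar>z\<bar>) / S \<le> \<bar>resid_sd \<theta> * z - \<alpha>\<bar> / s"
            using s by (intro frac_le) auto
          also have "\<dots> = \<bar>z / (s / resid_sd \<theta>) - \<alpha> / s\<bar>"
            using s by (simp add: abs_divide diff_divide_distrib[symmetric] mult.commute)
          finally show "\<rho> (f a z) \<le> \<rho> (z / (s / resid_sd \<theta>) - \<alpha> / s)"
            using S by (intro A3_mono[OF A3]) (simp add: f_def)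
        qed
        with a have "1 - \<eta> \<le> risk \<rho> Ho \<alpha> \<theta> s" by linarith
        then have "(1 - \<epsilon>) * (1 - \<eta>) \<le> (1 - \<epsilon>) * risk \<rho> Ho \<alpha> \<theta> s"
          using eps by (intro mult_left_mono) auto
        moreover have "0 \<le> \<epsilon> * \<rho> ((n * r - \<alpha> - n *\<^sub>R e \<bullet> \<theta>) / s)"
          using eps A3_nonneg[OF A3] by simp
        ultimately show ?thesis unfolding eq by (intro disjI1) linarith
      next
        case False
        have "e \<bullet> \<theta> \<le> t"
          using norm_cauchy_schwarz[of e \<theta>] e \<theta> by simp
        then have "n * (r - t) \<le> n * (r - e \<bullet> \<theta>)"
          using n0 by (intro mult_left_mono) auto
        moreover have "n * (r - e \<bullet> \<theta>) = n * r - n *\<^sub>R e \<bullet> \<theta>"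
          by (simp add: right_diff_distrib)
        ultimately have "a \<le> n * r - \<alpha> - n *\<^sub>R e \<bullet> \<theta>"
          using n False by linarith
        then have "a / S \<le> (n * r - \<alpha> - n *\<^sub>R e \<bullet> \<theta>) / s"
          using a(3) s by (intro frac_le) auto
        moreover have "0 < a / S" using a(3) S by simp
        ultimately have "\<rho> (a / S) \<le> \<rho> ((n * r - \<alpha> - n *\<^sub>R e \<bullet> \<theta>) / s)"
          by (intro A3_mono[OF A3]) linarith
        with a have "1 - \<eta> \<le> \<rho> ((n * r - \<alpha> - n *\<^sub>R e \<bullet> \<theta>) / s)" by linarith
        then have "\<epsilon> * (1 - \<eta>) \<le> \<epsilon> * \<rho> ((n * r - \<alpha> - n *\<^sub>R e \<bullet> \<theta>) / s)"
          using eps by (intro mult_left_mono) auto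
        moreover have "g_of \<rho> s \<le> g_of \<rho> (s / resid_sd \<theta>)"
          using s resid_sd_ge_1[of \<theta>] by (intro g_of_antimono[OF A3]) (auto simp: field_simps)
        then have "g_of \<rho> s \<le> risk \<rho> Ho \<alpha> \<theta> s"
          using risk_Ho_ge[OF A3 s(1), of \<theta> \<alpha>] by linarith
        then have "(1 - \<epsilon>) * g_of \<rho> s \<le> (1 - \<epsilon>) * risk \<rho> Ho \<alpha> \<theta> s"
          using eps by (intro mult_left_mono) auto
        ultimately show ?thesis unfolding eq by (intro disjI2) linarith
      qed
    qed
  qed
qed

subsection \<open>Unimodality and the bias bound\<close>

text \<open>The derivative of the difference below is \<open>(\<phi> s - \<phi> (s / R)) / s\<close> with \<open>\<phi> s = - s * deriv g s\<close>;
  by unimodality of \<open>\<phi>\<close> it stays nonpositive once it has become negative.\<close>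

lemma A4_dilation_diff_quasiconcave:
  fixes g :: "real \<Rightarrow> real"
  assumes A4: "cond_A4 g" and R: "R \<ge> 1" and s: "0 < a" "a \<le> s" "s \<le> c"
  shows "min (g (a / R) - g a) (g (c / R) - g c) \<le> g (s / R) - g s"
proof (rule ccontr)
  assume neg: "\<not> ?thesis"
  define \<phi> where "\<phi> s = - s * deriv g s" for s
  define k where "k s = g (s / R) - g s" for s
  define k' where "k' s = (\<phi> s - \<phi> (s / R)) / s" for s
  obtain m where m: "m > 0" and up: "mono_on {0<..m} \<phi>" and down: "antimono_on {m..} \<phi>"
    using A4 unfolding cond_A4_def \<phi>_def by blast
  have dg: "(g has_real_derivative deriv g x) (at x)" if "x > 0" for x
    using A4 that unfolding cond_A4_def C1_differentiable_on_def
    by (metis DERIV_imp_deriv greaterThan_iff has_real_derivative_iff_has_vector_derivative)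
  have dk: "(k has_real_derivative k' x) (at x)" if "x > 0" for x
  proof -
    have "x / R > 0" using that R by simp
    from dg[OF this] have "((\<lambda>x. g (x / R)) has_real_derivative deriv g (x / R) * (1 / R)) (at x)"
      by (rule DERIV_chain2) (use R in \<open>auto intro!: derivative_eq_intros\<close>)
    from DERIV_diff[OF this dg[OF that]]
    have "(k has_real_derivative deriv g (x / R) * (1 / R) - deriv g x) (at x)"
      by (simp add: k_def[abs_def])
    moreover have "deriv g (x / R) * (1 / R) - deriv g x = k' x"
      unfolding k'_def \<phi>_def using that R by (simp add: field_simps)
    ultimately show ?thesis by simp
  qed
  from neg have less: "k s < k a" "k s < k c" by (auto simp: k_def min_def split: if_splits)
  then have as: "a < s" "s < c" using s by (auto simp: less_le)
  obtain x where x: "a < x" "x < s" "k s - k a = (s - a) * k' x"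
    using MVT2[OF as(1), of k k'] dk s by force
  obtain y where y: "s < y" "y < c" "k c - k s = (c - s) * k' y"
    using MVT2[OF as(2), of k k'] dk s by force
  have pos: "x > 0" "y > 0" "x < y" using x y s by auto
  have "(s - a) * k' x < 0" using less x by simp
  then have "k' x < 0" using as by (simp add: mult_less_0_iff)
  then have xl: "\<phi> x < \<phi> (x / R)" using pos by (simp add: k'_def divide_less_0_iff)
  have "0 < (c - s) * k' y" using less y by simp
  then have "k' y > 0" using as by (simp add: zero_less_mult_iff)
  then have yl: "\<phi> (y / R) < \<phi> y" using pos by (simp add: k'_def zero_less_divide_iff)
  have le: "x / R \<le> x" "y / R \<le> y" "0 < x / R" "0 < y / R" "x / R \<le> y / R"
    using pos R by (auto simp: field_simps)
  have "m < x"
  proof (rule ccontr)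
    assume "\<not> m < x"
    then have "\<phi> (x / R) \<le> \<phi> x" using le pos by (intro mono_onD[OF up]) auto
    with xl show False by simp
  qed
  then have "\<phi> y \<le> \<phi> x" using pos by (intro monotone_onD[OF down]) auto
  show False
  proof (cases "y / R \<le> m")
    case True
    then have "\<phi> (x / R) \<le> \<phi> (y / R)" using le by (intro mono_onD[OF up]) auto
    with xl yl \<open>\<phi> y \<le> \<phi> x\<close> show False by simp
  next
    case False
    then have "\<phi> y \<le> \<phi> (y / R)" using le by (intro monotone_onD[OF down]) auto
    with yl show False by simp
  qed
qed

lemma g_of_div_sqrt_strict_mono:
  assumes "cond_A3 \<rho>" "u > 0" "\<rho> u < 1" "s > 0" "0 \<le> t" "t < t'"
  shows "g_of \<rho> (s / sqrt (1 + t\<^sup>2)) < g_of \<rho> (s / sqrt (1 + t'\<^sup>2))"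
proof (rule g_of_strict_antimono[OF assms(1-3)])
  have "t\<^sup>2 < t'\<^sup>2" using assms by (intro power_strict_mono) auto
  then show "s / sqrt (1 + t'\<^sup>2) < s / sqrt (1 + t\<^sup>2)"
    using assms by (intro divide_strict_left_mono mult_pos_pos) (auto simp: add_pos_nonneg)
  show "0 < s / sqrt (1 + t'\<^sup>2)" using assms by (auto simp: add_pos_nonneg)
qed

lemma bias_bound_characterization:
  assumes A3: "cond_A3 \<rho>" and cont: "continuous_on {0<..} (g_of \<rho>)" and s: "s > 0"
    and eps: "0 < \<epsilon>" "\<epsilon> < 1" and lt: "g_of \<rho> s + \<epsilon> / (1 - \<epsilon>) < 1"
  shows "0 \<le> bias_bound \<rho> \<epsilon> s"
    and "g_of \<rho> (s / sqrt (1 + (bias_bound \<rho> \<epsilon> s)\<^sup>2)) = g_of \<rho> s + \<epsilon> / (1 - \<epsilon>)"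
proof -
  define w where "w = g_inv \<rho> (g_of \<rho> s + \<epsilon> / (1 - \<epsilon>))"
  have e: "\<epsilon> / (1 - \<epsilon>) > 0" using eps by simp
  have w: "w > 0" "g_of \<rho> w = g_of \<rho> s + \<epsilon> / (1 - \<epsilon>)"
    unfolding w_def using g_inv_correct[OF A3 cont s _ lt] e by auto
  have "w < s"
  proof (rule ccontr)
    assume "\<not> w < s"
    then have "g_of \<rho> w \<le> g_of \<rho> s" using s by (intro g_of_antimono[OF A3]) auto
    with w e show False by simp
  qed
  then have "1 \<le> s / w" using w by simp
  then have sq: "1 \<le> (s / w)\<^sup>2" by (rule one_le_power)
  have bb: "bias_bound \<rho> \<epsilon> s = sqrt ((s / w)\<^sup>2 - 1)" by (simp add: bias_bound_def w_def)
  show "0 \<le> bias_bound \<rho> \<epsilon> s" using sq by (simp add: bb)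
  have "sqrt (1 + (bias_bound \<rho> \<epsilon> s)\<^sup>2) = s / w"
    unfolding bb using sq s w by simp
  then show "g_of \<rho> (s / sqrt (1 + (bias_bound \<rho> \<epsilon> s)\<^sup>2)) = g_of \<rho> s + \<epsilon> / (1 - \<epsilon>)"
    using w s by simp
qed

lemma h1_eq:
  assumes A3: "cond_A3 \<rho>" and "s > 0" "t \<ge> 0"
  shows "h1 TYPE('p::finite) \<rho> s t = g_of \<rho> (s / sqrt (1 + t\<^sup>2)) - g_of \<rho> s"
proof -
  have inf: "(INF \<alpha>. risk \<rho> Ho \<alpha> \<theta> s) = g_of \<rho> (s / resid_sd \<theta>)" for \<theta> :: "real ^ 'p"
  proof (rule cInf_eq_minimum)
    show "g_of \<rho> (s / resid_sd \<theta>) \<in> range (\<lambda>\<alpha>. risk \<rho> Ho \<alpha> \<theta> s)"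
      using risk_Ho_0[OF A3, of \<theta> s] by (metis rangeI)
  qed (auto intro: risk_Ho_ge[OF A3 assms(2)])
  obtain \<theta> :: "real ^ 'p" where "norm \<theta> = t"
    using vector_choose_size[OF assms(3)] .
  then have ne: "{\<theta> :: real ^ 'p. norm \<theta> = t} \<noteq> {}" by auto
  have "(INF \<theta> \<in> {\<theta> :: real ^ 'p. norm \<theta> = t}. INF \<alpha>. risk \<rho> Ho \<alpha> \<theta> s)
      = (INF \<theta> \<in> {\<theta> :: real ^ 'p. norm \<theta> = t}. g_of \<rho> (s / sqrt (1 + t\<^sup>2)))"
    unfolding inf by (intro INF_cong) (auto simp: resid_sd_def)
  also have "\<dots> = g_of \<rho> (s / sqrt (1 + t\<^sup>2))"
    using ne by (rule cINF_const)
  finally show ?thesis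
    unfolding h1_def risk_Ho_0[OF A3] by (simp add: resid_sd_def)
qed

lemma h1_inverse_eq:
  assumes "cond_A3 \<rho>" "u > 0" "\<rho> u < 1" "s > 0" "l \<ge> 0"
    and "g_of \<rho> (s / sqrt (1 + l\<^sup>2)) = g_of \<rho> s + e"
  shows "inv_into {0..} (h1 TYPE('p::finite) \<rho> s) e = l"
proof (rule inv_into_f_eq)
  have "strict_mono_on {0..} (h1 TYPE('p) \<rho> s)"
    by (rule strict_mono_onI)
      (use assms in \<open>auto simp: h1_eq intro!: g_of_div_sqrt_strict_mono[where u = u]\<close>)
  then show "inj_on (h1 TYPE('p) \<rho> s) {0..}"
    by (rule strict_mono_on_imp_inj_on)
qed (use assms in \<open>auto simp: h1_eq\<close>)

subsection \<open>S-scales over the contamination neighbourhood\<close>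

lemma S_solution_scale_unique:
  "S_solution \<rho> b H \<alpha> \<theta> s \<Longrightarrow> S_solution \<rho> b H \<alpha>' \<theta>' s' \<Longrightarrow> s = s'"
  unfolding S_solution_def by (meson order_antisym)

lemma S_solution_scale_le:
  fixes H :: "(real \<times> (real ^ 'p)) measure"
  assumes "cond_A3 \<rho>" "0 < \<epsilon>" "\<epsilon> < 1" "H \<in> contam \<epsilon>" "S_solution \<rho> b H \<alpha> \<theta> s"
    and "\<sigma> > 0" "g_of \<rho> \<sigma> = (b - \<epsilon>) / (1 - \<epsilon>)"
  shows "s \<le> \<sigma>"
proof -
  have "(1 - \<epsilon>) * g_of \<rho> \<sigma> + \<epsilon> = b" using assms by simp
  then have "risk \<rho> H 0 0 \<sigma> \<le> b"
    using contam_risk_0_le[OF assms(4,2,3,1), of \<sigma>] by simp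
  then show ?thesis using assms(5,6) unfolding S_solution_def by blast
qed

lemma S_solution_scale_ge:
  fixes H :: "(real \<times> (real ^ 'p)) measure"
  assumes A3: "cond_A3 \<rho>" and u: "u > 0" "\<rho> u < 1" and eps: "0 < \<epsilon>" "\<epsilon> < 1"
    and H: "H \<in> contam \<epsilon>" and S: "S_solution \<rho> b H \<alpha> \<theta> s"
    and \<gamma>: "\<gamma> > 0" "g_of \<rho> \<gamma> = b / (1 - \<epsilon>)"
  shows "\<gamma> \<le> s"
proof (rule ccontr)
  have s: "s > 0" "risk \<rho> H \<alpha> \<theta> s \<le> b" using S by (auto simp: S_solution_def)
  assume "\<not> \<gamma> \<le> s"
  then have "g_of \<rho> \<gamma> < g_of \<rho> s" using s by (intro g_of_strict_antimono[OF A3 u]) auto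
  also have "g_of \<rho> s \<le> g_of \<rho> (s / resid_sd \<theta>)"
    using s resid_sd_ge_1[of \<theta>] by (intro g_of_antimono[OF A3]) (auto simp: field_simps)
  finally have "(1 - \<epsilon>) * g_of \<rho> \<gamma> < (1 - \<epsilon>) * g_of \<rho> (s / resid_sd \<theta>)"
    using eps by simp
  also have "\<dots> \<le> risk \<rho> H \<alpha> \<theta> s" by (rule contam_risk_ge[OF H eps A3 s(1)])
  finally show False using s \<gamma> eps by simp
qed

lemma half_min_less:
  fixes a b :: real
  assumes "0 < a" "0 < b"
  shows "min a b / 2 < a" "min a b / 2 < b"
  using assms by (auto simp: min_def)

lemma S_scale_point_contam:
  fixes e :: "real ^ 'p"
  assumes A3: "cond_A3 \<rho>" and u: "u > 0" "\<rho> u < 1" and eps: "0 < \<epsilon>" "\<epsilon> < 1" "\<epsilon> < 1 - b"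
    and \<sigma>: "g_of \<rho> \<sigma> = (b - \<epsilon>) / (1 - \<epsilon>)" and s0: "0 < s0" "s0 < \<sigma>"
    and t: "t < r" and e: "norm e = 1"
  shows "\<forall>\<^sub>F n in at_top. \<forall>\<alpha> \<theta> s. norm \<theta> \<le> t \<longrightarrow>
    S_solution \<rho> b (point_contam \<epsilon> (n * r, n *\<^sub>R e)) \<alpha> \<theta> s \<longrightarrow> s0 < s"
proof -
  have "g_of \<rho> \<sigma> < g_of \<rho> s0" using s0 by (intro g_of_strict_antimono[OF A3 u])
  then have "(1 - \<epsilon>) * g_of \<rho> \<sigma> < (1 - \<epsilon>) * g_of \<rho> s0" using eps by simp
  then have d: "0 < (1 - \<epsilon>) * g_of \<rho> s0 + \<epsilon> - b" using \<sigma> eps by simp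
  define \<eta> where "\<eta> = min (1 - \<epsilon> - b) ((1 - \<epsilon>) * g_of \<rho> s0 + \<epsilon> - b) / 2"
  have d': "0 < 1 - \<epsilon> - b" using eps by simp
  have eta: "\<eta> > 0" using d eps by (simp add: \<eta>_def)
  have "(1 - \<epsilon>) * \<eta> \<le> 1 * \<eta>" "\<epsilon> * \<eta> \<le> 1 * \<eta>"
    using eps eta by (intro mult_right_mono; simp)+
  moreover have "\<eta> < 1 - \<epsilon> - b" "\<eta> < (1 - \<epsilon>) * g_of \<rho> s0 + \<epsilon> - b"
    using half_min_less[OF d'] d by (simp_all add: \<eta>_def)
  ultimately have 1: "b < (1 - \<epsilon>) * (1 - \<eta>)" and 2: "b < (1 - \<epsilon>) * g_of \<rho> s0 + \<epsilon> * (1 - \<eta>)"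
    by (simp_all add: algebra_simps)
  show ?thesis
    using risk_point_contam_lower[OF A3 eps(1,2) t e s0(1) eta]
  proof eventually_elim
    case (elim n)
    show ?case
    proof (intro allI impI, rule ccontr)
      fix \<alpha> s :: real and \<theta> :: "real ^ 'p"
      assume th: "norm \<theta> \<le> t" and S: "S_solution \<rho> b (point_contam \<epsilon> (n * r, n *\<^sub>R e)) \<alpha> \<theta> s"
        and "\<not> s0 < s"
      then have s: "0 < s" "s \<le> s0" and le: "risk \<rho> (point_contam \<epsilon> (n * r, n *\<^sub>R e)) \<alpha> \<theta> s \<le> b"
        by (auto simp: S_solution_def)
      have "(1 - \<epsilon>) * g_of \<rho> s0 \<le> (1 - \<epsilon>) * g_of \<rho> s"
        using s eps by (intro mult_left_mono g_of_antimono[OF A3]) auto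
      then show False
        using elim[rule_format, OF th s, of \<alpha>] le 1 2 by linarith
    qed
  qed
qed

lemma max_S_scale_eq:
  assumes A3: "cond_A3 \<rho>" and u: "u > 0" "\<rho> u < 1" and eps: "0 < \<epsilon>" "\<epsilon> < 1" "\<epsilon> < 1 - b"
    and \<sigma>: "\<sigma> > 0" "g_of \<rho> \<sigma> = (b - \<epsilon>) / (1 - \<epsilon>)"
    and bounded: "\<And>H :: (real \<times> (real ^ 'p::finite)) measure. H \<in> contam \<epsilon> \<Longrightarrow>
      \<exists>\<alpha> \<theta> s. S_solution \<rho> b H \<alpha> \<theta> s \<and> norm \<theta> \<le> t"
  shows "max_S_scale TYPE('p) \<rho> b \<epsilon> = \<sigma>"
  unfolding max_S_scale_def
proof (rule cSup_eq)
  fix s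
  assume "s \<in> {s. \<exists>H \<in> (contam \<epsilon> :: (real \<times> (real ^ 'p)) measure set). is_S_scale \<rho> b H s}"
  then show "s \<le> \<sigma>"
    using S_solution_scale_le[OF A3 eps(1,2) _ _ \<sigma>] by (auto simp: is_S_scale_def)
next
  fix y
  assume y: "\<And>s. s \<in> {s. \<exists>H \<in> (contam \<epsilon> :: (real \<times> (real ^ 'p)) measure set). is_S_scale \<rho> b H s} \<Longrightarrow> s \<le> y"
  show "\<sigma> \<le> y"
  proof (rule ccontr)
    assume "\<not> \<sigma> \<le> y"
    with \<sigma> have s0: "0 < max y (\<sigma> / 2)" "max y (\<sigma> / 2) < \<sigma>" by auto
    obtain e :: "real ^ 'p" where e: "norm e = 1"
      using vector_choose_size[of 1] by auto
    have "t < t + 1" by simp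
    from eventually_happens'[OF _ S_scale_point_contam[OF A3 u eps \<sigma>(2) s0 this e]]
    obtain n where n: "\<And>\<alpha> \<theta> s. norm \<theta> \<le> t \<Longrightarrow>
        S_solution \<rho> b (point_contam \<epsilon> (n * (t + 1), n *\<^sub>R e)) \<alpha> \<theta> s \<Longrightarrow> max y (\<sigma> / 2) < s"
      by auto
    have H: "point_contam \<epsilon> (n * (t + 1), n *\<^sub>R e) \<in> contam \<epsilon>"
      by (rule point_contam_in_contam[OF eps(1,2)])
    from bounded[OF this] obtain \<alpha> \<theta> s where
      S: "S_solution \<rho> b (point_contam \<epsilon> (n * (t + 1), n *\<^sub>R e)) \<alpha> \<theta> s" "norm \<theta> \<le> t"
      by blast
    have "s \<le> y" by (rule y) (use H S in \<open>auto simp: is_S_scale_def\<close>)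
    with n[OF S(2,1)] show False by simp
  qed
qed

subsection \<open>The maximum bias of MM-estimates\<close>

lemma MM_solution_slope_bound:
  fixes H :: "(real \<times> (real ^ 'p)) measure"
  assumes A3: "cond_A3 \<rho>" and eps: "0 < \<epsilon>" "\<epsilon> < 1" and H: "H \<in> contam \<epsilon>" and s: "s > 0"
    and min: "\<And>\<alpha>' \<theta>'. risk \<rho> H \<alpha> \<theta> s \<le> risk \<rho> H \<alpha>' \<theta>' s"
  shows "g_of \<rho> (s / sqrt (1 + (norm \<theta>)\<^sup>2)) \<le> g_of \<rho> s + \<epsilon> / (1 - \<epsilon>)"
proof -
  have "(1 - \<epsilon>) * g_of \<rho> (s / resid_sd \<theta>) \<le> (1 - \<epsilon>) * g_of \<rho> s + \<epsilon>"
    using contam_risk_ge[OF H eps A3 s, of \<theta> \<alpha>] contam_risk_0_le[OF H eps A3, of s] min[of 0 0]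
    by linarith
  then show ?thesis using eps by (simp add: resid_sd_def field_simps)
qed

lemma max_bias_witness:
  assumes "max_bias T \<epsilon> \<le> ereal t" "H \<in> contam \<epsilon>"
  obtains \<theta> where "T H = Some \<theta>" "norm \<theta> \<le> t"
proof -
  have "bias T H \<le> max_bias T \<epsilon>"
    unfolding max_bias_def by (rule SUP_upper[OF assms(2)])
  also have "\<dots> \<le> ereal t" by fact
  finally show ?thesis by (cases "T H") (auto simp: bias_def intro: that)
qed

lemma contam_subset_prob_measures: "contam \<epsilon> \<subseteq> prob_measures"
  by (auto simp: contam_def)

theorem theorem4p2:
  fixes \<rho>1 \<rho>2 :: "real \<Rightarrow> real"
    and b \<epsilon> :: real
    and T_S T_MM :: "(real \<times> (real ^ 'p::finite)) measure \<Rightarrow> (real ^ 'p) option"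
  assumes "cond_A3 \<rho>1" and "cond_A3 \<rho>2"
    and "\<And>u. \<rho>1 u \<ge> \<rho>2 u" and "\<rho>1 \<noteq> \<rho>2"
    and "b = (\<integral>y. \<rho>1 y \<partial>std_normal_distribution)"
    and "0 < \<epsilon>" and "\<epsilon> < min b (1 - b)"
    and "(b - \<epsilon>) / (1 - \<epsilon>) \<in> g_of \<rho>1 ` {0<..}"
    and "b / (1 - \<epsilon>) \<in> g_of \<rho>1 ` {0<..}"
    and "g_of \<rho>2 (sigma_be \<rho>1 b \<epsilon>) + \<epsilon> / (1 - \<epsilon>) < 1"
    and "g_of \<rho>2 (gamma_be \<rho>1 b \<epsilon>) + \<epsilon> / (1 - \<epsilon>) < 1"
    and "S_slopes \<rho>1 b T_S"
    and "MM_slopes \<rho>1 \<rho>2 b T_MM"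
    and MM_exists: "\<And>H :: (real \<times> (real ^ 'p)) measure.
           H \<in> contam \<epsilon> \<Longrightarrow> \<exists>\<alpha> \<theta>. MM_solution \<rho>1 \<rho>2 b H \<alpha> \<theta>"
    and "max_bias T_S \<epsilon> <
           ereal (inv_into {0..} (h1 TYPE('p) \<rho>2 (max_S_scale TYPE('p) \<rho>1 b \<epsilon>)) (\<epsilon> / (1 - \<epsilon>)))"
    and "cond_A4 (g_of \<rho>2)"
  shows "ereal (bias_bound \<rho>2 \<epsilon> (sigma_be \<rho>1 b \<epsilon>)) \<le> max_bias T_MM \<epsilon> \<and>
         max_bias T_MM \<epsilon> \<le>
           ereal (max (bias_bound \<rho>2 \<epsilon> (sigma_be \<rho>1 b \<epsilon>)) (bias_bound \<rho>2 \<epsilon> (gamma_be \<rho>1 b \<epsilon>)))"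
proof -
  note A3_1 = assms(1) and A3_2 = assms(2)
  have b: "b < 1" and eps: "0 < \<epsilon>" "\<epsilon> < 1" "\<epsilon> < 1 - b" using assms(6,7) by auto
  define \<sigma> where "\<sigma> = sigma_be \<rho>1 b \<epsilon>"
  define \<gamma> where "\<gamma> = gamma_be \<rho>1 b \<epsilon>"
  define l where "l = bias_bound \<rho>2 \<epsilon> \<sigma>"
  have \<sigma>: "\<sigma> > 0" "g_of \<rho>1 \<sigma> = (b - \<epsilon>) / (1 - \<epsilon>)"
    using inv_into_into[OF assms(8)] f_inv_into_f[OF assms(8)]
    by (simp_all add: \<sigma>_def sigma_be_def g_inv_def)
  have \<gamma>: "\<gamma> > 0" "g_of \<rho>1 \<gamma> = b / (1 - \<epsilon>)"
    using inv_into_into[OF assms(9)] f_inv_into_f[OF assms(9)]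
    by (simp_all add: \<gamma>_def gamma_be_def g_inv_def)
  have lt\<sigma>: "g_of \<rho>2 \<sigma> + \<epsilon> / (1 - \<epsilon>) < 1" and lt\<gamma>: "g_of \<rho>2 \<gamma> + \<epsilon> / (1 - \<epsilon>) < 1"
    using assms(10,11) by (simp_all add: \<sigma>_def \<gamma>_def)
  have "\<exists>u>0. \<rho>1 u < 1"
  proof (rule ccontr)
    assume no: "\<not> ?thesis"
    have one: "\<rho>1 u = 1" if "u \<noteq> 0" for u
    proof -
      have "\<not> \<rho>1 \<bar>u\<bar> < 1" using no that by simp
      then show ?thesis using A3_le_1[OF A3_1, of u] A3_abs[OF A3_1, of u] by linarith
    qed
    interpret prob_space std_normal_distribution by (rule prob_space_std_normal)
    have "b = (\<integral>y. 1 \<partial>std_normal_distribution)"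
      unfolding assms(5)
    proof (rule integral_cong_AE)
      show "AE y in std_normal_distribution. \<rho>1 y = 1"
        unfolding AE_std_normal_iff using AE_lborel_singleton[of "0::real"]
        by eventually_elim (rule one)
    qed (use A3_measurable[OF A3_1] in simp_all)
    then show False using b prob_space by simp
  qed
  then obtain u where u: "u > 0" "\<rho>1 u < 1" by blast
  have u2: "\<rho>2 u < 1" using assms(3)[of u] u by simp
  have cont: "continuous_on {0<..} (g_of \<rho>2)" by (rule g_of_A4_continuous[OF assms(16)])
  note l = bias_bound_characterization[OF A3_2 cont \<sigma>(1) eps(1,2) lt\<sigma>, folded l_def]
  note mono2 = g_of_div_sqrt_strict_mono[OF A3_2 u(1) u2]

  have S_ex: "\<exists>\<alpha> \<theta> s. S_solution \<rho>1 b H \<alpha> \<theta> s \<and> norm \<theta> \<le> t"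
    if bd: "max_bias T_S \<epsilon> \<le> ereal t" and H: "H \<in> contam \<epsilon>" for t and H :: "(real \<times> (real ^ 'p)) measure"
  proof -
    obtain \<theta> where \<theta>: "T_S H = Some \<theta>" "norm \<theta> \<le> t" by (rule max_bias_witness[OF bd H])
    have "H \<in> prob_measures" using H contam_subset_prob_measures by blast
    from bspec[OF assms(12)[unfolded S_slopes_def] this] \<theta> show ?thesis by auto
  qed
  have MM_ex: "\<exists>\<theta> \<alpha>. T_MM H = Some \<theta> \<and> MM_solution \<rho>1 \<rho>2 b H \<alpha> \<theta>"
    if H: "H \<in> contam \<epsilon>" for H :: "(real \<times> (real ^ 'p)) measure"
  proof -
    have "H \<in> prob_measures" using H contam_subset_prob_measures by blast
    from bspec[OF assms(13)[unfolded MM_slopes_def] this] MM_exists[OF H] show ?thesis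
      by (auto split: option.splits)
  qed

  have "max_S_scale TYPE('p) \<rho>1 b \<epsilon> = \<sigma>"
    by (rule max_S_scale_eq[OF A3_1 u eps \<sigma> S_ex[OF less_imp_le[OF assms(15)]]])
  moreover have "inv_into {0..} (h1 TYPE('p) \<rho>2 \<sigma>) (\<epsilon> / (1 - \<epsilon>)) = l"
    by (rule h1_inverse_eq[OF A3_2 u(1) u2 \<sigma>(1) l])
  ultimately have BS: "max_bias T_S \<epsilon> < ereal l" using assms(15) by simp

  have "ereal l \<le> max_bias T_MM \<epsilon>"
  proof (rule ccontr)
    assume "\<not> ereal l \<le> max_bias T_MM \<epsilon>"
    with BS have "max (max_bias T_S \<epsilon>) (max_bias T_MM \<epsilon>) < ereal l" by simp
    then obtain t where t: "max (max_bias T_S \<epsilon>) (max_bias T_MM \<epsilon>) < ereal t" "ereal t < ereal l"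
      using ereal_dense2 by blast
    then have tS: "max_bias T_S \<epsilon> \<le> ereal t" and tM: "max_bias T_MM \<epsilon> \<le> ereal t"
      by (auto intro: less_imp_le)
    obtain e :: "real ^ 'p" where e: "norm e = 1"
      using vector_choose_size[of 1] by auto
    have "0 \<le> t"
      using S_ex[OF tS point_contam_in_contam[OF eps(1,2), of "0 :: real \<times> (real ^ 'p)"]] norm_ge_zero order_trans by blast
    define r where "r = (t + l) / 2"
    have r: "t < r" "r < l" "0 \<le> r" using t \<open>0 \<le> t\<close> by (auto simp: r_def)
    define q where "q = sqrt (1 + r\<^sup>2)"
    have q: "q > 0" by (simp add: q_def add_pos_nonneg)
    have "g_of \<rho>2 (\<sigma> / q) < g_of \<rho>2 \<sigma> + \<epsilon> / (1 - \<epsilon>)"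
      using mono2[OF \<sigma>(1) r(3,2)] l by (simp add: q_def)
    moreover have "((\<lambda>s. g_of \<rho>2 (s / q)) \<longlongrightarrow> g_of \<rho>2 (\<sigma> / q)) (at_left \<sigma>)"
    proof (rule isCont_tendsto_compose[of _ "g_of \<rho>2"])
      show "isCont (g_of \<rho>2) (\<sigma> / q)"
        using cont \<sigma>(1) q by (simp add: continuous_on_eq_continuous_at)
      show "((\<lambda>s. s / q) \<longlongrightarrow> \<sigma> / q) (at_left \<sigma>)"
        using q by (intro tendsto_intros) auto
    qed
    ultimately have "\<forall>\<^sub>F s in at_left \<sigma>. g_of \<rho>2 (s / q) < g_of \<rho>2 \<sigma> + \<epsilon> / (1 - \<epsilon>)"
      by (intro order_tendstoD(2))
    moreover have "\<forall>\<^sub>F s in at_left \<sigma>. s \<in> {0<..<\<sigma>}"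
      by (rule eventually_at_left_real[OF \<sigma>(1)])
    ultimately have "\<forall>\<^sub>F s in at_left \<sigma>. g_of \<rho>2 (s / q) < g_of \<rho>2 \<sigma> + \<epsilon> / (1 - \<epsilon>) \<and> s \<in> {0<..<\<sigma>}"
      by (rule eventually_conj)
    then obtain s0 where s0: "0 < s0" "s0 < \<sigma>"
      and g0: "g_of \<rho>2 (s0 / q) < g_of \<rho>2 \<sigma> + \<epsilon> / (1 - \<epsilon>)"
      using eventually_happens'[of "at_left \<sigma>"] by auto
    define G where "G = g_of \<rho>2 (s0 / q)"
    define \<eta> where "\<eta> = min (1 - G) ((1 - \<epsilon>) * (g_of \<rho>2 \<sigma> + \<epsilon> / (1 - \<epsilon>) - G)) / 2"
    have pos: "0 < 1 - G" "0 < (1 - \<epsilon>) * (g_of \<rho>2 \<sigma> + \<epsilon> / (1 - \<epsilon>) - G)"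
      using g0 lt\<sigma> eps by (auto simp: G_def intro!: mult_pos_pos)
    then have eta: "\<eta> > 0" by (simp add: \<eta>_def)
    have eta': "\<eta> < 1 - G" "\<eta> < (1 - \<epsilon>) * (g_of \<rho>2 \<sigma> + \<epsilon> / (1 - \<epsilon>) - G)"
      using half_min_less[OF pos] by (simp_all add: \<eta>_def)
    have "(1 - \<epsilon>) * G < (1 - \<epsilon>) * (1 - \<eta>)"
      using eta' eps by (intro mult_strict_left_mono) auto
    moreover have "(1 - \<epsilon>) * (g_of \<rho>2 \<sigma> + \<epsilon> / (1 - \<epsilon>) - G) = (1 - \<epsilon>) * g_of \<rho>2 \<sigma> + \<epsilon> - (1 - \<epsilon>) * G"
      using eps by (simp add: right_diff_distrib distrib_left)
    moreover have "\<epsilon> * \<eta> \<le> 1 * \<eta>" using eps eta by (intro mult_right_mono) auto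
    ultimately have 1: "(1 - \<epsilon>) * G < (1 - \<epsilon>) * (1 - \<eta>)"
      and 2: "(1 - \<epsilon>) * G < (1 - \<epsilon>) * g_of \<rho>2 \<sigma> + \<epsilon> * (1 - \<eta>)"
      using eta' by (simp_all add: right_diff_distrib[of \<epsilon>])
    obtain n where n:
      "(\<forall>\<alpha> \<theta> s. norm \<theta> \<le> t \<longrightarrow> S_solution \<rho>1 b (point_contam \<epsilon> (n * r, n *\<^sub>R e)) \<alpha> \<theta> s \<longrightarrow> s0 < s) \<and>
       (\<forall>\<alpha> \<theta> s. norm \<theta> \<le> t \<longrightarrow> 0 < s \<longrightarrow> s \<le> \<sigma> \<longrightarrow>
          (1 - \<epsilon>) * (1 - \<eta>) \<le> risk \<rho>2 (point_contam \<epsilon> (n * r, n *\<^sub>R e)) \<alpha> \<theta> s \<or>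
          (1 - \<epsilon>) * g_of \<rho>2 s + \<epsilon> * (1 - \<eta>) \<le> risk \<rho>2 (point_contam \<epsilon> (n * r, n *\<^sub>R e)) \<alpha> \<theta> s)"
      using eventually_happens'[OF trivial_limit_at_top_linorder
          eventually_conj[OF S_scale_point_contam[OF A3_1 u eps \<sigma>(2) s0 r(1) e]
            risk_point_contam_lower[OF A3_2 eps(1,2) r(1) e \<sigma>(1) eta]]] ..
    note nS = conjunct1[OF n, rule_format] and nR = conjunct2[OF n, rule_format]
    define H where "H = point_contam \<epsilon> (n * r, n *\<^sub>R e)"
    have H: "H \<in> contam \<epsilon>" unfolding H_def by (rule point_contam_in_contam[OF eps(1,2)])
    obtain \<theta> \<alpha> s \<alpha>1 \<theta>1 where TM: "T_MM H = Some \<theta>" and S1: "S_solution \<rho>1 b H \<alpha>1 \<theta>1 s"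
      and min: "\<And>\<alpha>' \<theta>'. risk \<rho>2 H \<alpha> \<theta> s \<le> risk \<rho>2 H \<alpha>' \<theta>' s"
      using MM_ex[OF H] unfolding MM_solution_def is_S_scale_def by blast
    have \<theta>: "norm \<theta> \<le> t" using max_bias_witness[OF tM H] TM by force
    obtain \<alpha>2 \<theta>2 s2 where S2: "S_solution \<rho>1 b H \<alpha>2 \<theta>2 s2" "norm \<theta>2 \<le> t"
      using S_ex[OF tS H] by blast
    have s: "s0 < s" "s \<le> \<sigma>"
      using nS[OF S2(2) S2(1)[unfolded H_def]] S_solution_scale_unique[OF S1 S2(1)]
        S_solution_scale_le[OF A3_1 eps(1,2) H S1 \<sigma>] by simp_all
    have "resid_sd (r *\<^sub>R e) = q" using e by (simp add: resid_sd_def q_def power_mult_distrib)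
    moreover have "e \<bullet> e = 1" using e by (simp add: dot_square_norm)
    ultimately have "risk \<rho>2 H 0 (r *\<^sub>R e) s = (1 - \<epsilon>) * g_of \<rho>2 (s / q)"
      unfolding H_def risk_point_contam[OF A3_2 eps(1,2)] risk_Ho_0[OF A3_2]
      by (simp add: A3_zero[OF A3_2] mult.commute)
    also have "\<dots> \<le> (1 - \<epsilon>) * G"
      unfolding G_def using eps s s0 q
      by (intro mult_left_mono g_of_antimono[OF A3_2] divide_right_mono) auto
    finally have "risk \<rho>2 H \<alpha> \<theta> s \<le> (1 - \<epsilon>) * G" using min[of 0 "r *\<^sub>R e"] by linarith
    moreover have "(1 - \<epsilon>) * g_of \<rho>2 \<sigma> \<le> (1 - \<epsilon>) * g_of \<rho>2 s"
      using eps s s0 by (intro mult_left_mono g_of_antimono[OF A3_2]) auto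
    ultimately show False
      using nR[OF \<theta>, of s \<alpha>] s s0 1 2 unfolding H_def by linarith
  qed
  moreover have "max_bias T_MM \<epsilon> \<le> ereal (max l (bias_bound \<rho>2 \<epsilon> \<gamma>))"
    unfolding max_bias_def
  proof (rule SUP_least)
    fix H :: "(real \<times> (real ^ 'p)) measure" assume H: "H \<in> contam \<epsilon>"
    obtain \<theta> \<alpha> s \<alpha>1 \<theta>1 where TM: "T_MM H = Some \<theta>" and S1: "S_solution \<rho>1 b H \<alpha>1 \<theta>1 s"
      and min: "\<And>\<alpha>' \<theta>'. risk \<rho>2 H \<alpha> \<theta> s \<le> risk \<rho>2 H \<alpha>' \<theta>' s"
      using MM_ex[OF H] unfolding MM_solution_def is_S_scale_def by blast
    have s: "\<gamma> \<le> s" "s \<le> \<sigma>" "0 < s"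
      using S_solution_scale_ge[OF A3_1 u eps(1,2) H S1 \<gamma>]
        S_solution_scale_le[OF A3_1 eps(1,2) H S1 \<sigma>] \<gamma>(1) by linarith+
    define R where "R = sqrt (1 + (norm \<theta>)\<^sup>2)"
    have R: "R \<ge> 1" by (simp add: R_def)
    have le: "g_of \<rho>2 (s / R) - g_of \<rho>2 s \<le> \<epsilon> / (1 - \<epsilon>)"
      using MM_solution_slope_bound[OF A3_2 eps(1,2) H s(3) min] by (simp add: R_def)
    have gt: "\<epsilon> / (1 - \<epsilon>) < g_of \<rho>2 (x / R) - g_of \<rho>2 x"
      if "x > 0" "g_of \<rho>2 x + \<epsilon> / (1 - \<epsilon>) < 1" "bias_bound \<rho>2 \<epsilon> x < norm \<theta>" for x
      using mono2[OF that(1) _ that(3)] bias_bound_characterization[OF A3_2 cont that(1) eps(1,2) that(2)]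
      by (simp add: R_def)
    have "norm \<theta> \<le> max l (bias_bound \<rho>2 \<epsilon> \<gamma>)"
    proof (rule ccontr)
      assume "\<not> ?thesis"
      then have "\<epsilon> / (1 - \<epsilon>) < min (g_of \<rho>2 (\<gamma> / R) - g_of \<rho>2 \<gamma>) (g_of \<rho>2 (\<sigma> / R) - g_of \<rho>2 \<sigma>)"
        using gt[OF \<sigma>(1) lt\<sigma>] gt[OF \<gamma>(1) lt\<gamma>] by (simp add: l_def)
      also have "\<dots> \<le> g_of \<rho>2 (s / R) - g_of \<rho>2 s"
        by (rule A4_dilation_diff_quasiconcave[OF assms(16) R \<gamma>(1) s(1,2)])
      finally show False using le by simp
    qed
    then show "bias T_MM H \<le> ereal (max l (bias_bound \<rho>2 \<epsilon> \<gamma>))"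
      unfolding bias_def TM option.case(2) by (simp only: ereal_less_eq(3))
  qed
  ultimately show ?thesis by (simp add: l_def \<sigma>_def \<gamma>_def)
qed

end
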